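(* Let $r\ge 0$ be an integer, let $\Theta_1,\dots,\Theta_n$ be i.i.d. circular random variables with density $f$, let $(K_\nu)$ be a circular kernel family, let $(\nu_n)$ be a (non-random) sequence of smoothing parameters, and let $\hat f^{(r)}_{\nu}(\theta)=\frac1n\sum_{i=1}^n K_\nu^{(r)}(\theta-\Theta_i)$. Assume: (A1) $f^{(r+2)}$ is continuous and square-integrable on $[-\pi,\pi)$. (A2) $K$ is a bounded circular density, reflectively symmetric about zero, unimodal, and its $r$-th derivative is square-integrable on $[-\pi,\pi)$. (A3) As $n\to\infty$: $h_K(\nu_n)\to 0$, $R_{K;r,2}(\nu_n)\to\infty$ and $n^{-1}R_{K;r,2}(\nu_n)\to 0$. Then, as $n\to\infty$, $$\mathrm{AMISE}\big[\hat f^{(r)}_{\nu_n}\big]=O\big(h_K^2(\nu_n)\big)+O\big(n^{-1}R_{K;r,2}(\nu_n)\big).$$ If, in addition, as $n\to\infty$, (E1) $\int_{-\pi}^{\pi}\theta^4K_{\nu_n}(\theta)\,d\theta=o\big(h_K(\nu_n)\big)$, and (E2) $\int_{-\pi}^{\pi}\theta^2\big(K^{(r)}_{\nu_n}(\theta)\big)^2d\theta=o\big(R_{K;r,2}(\nu_n)\big)$, then $$\mathrm{AMISE}\big[\hat f^{(r)}_{\nu_n}\big]=\frac14h_K^2(\nu_n)\int_{-\pi}^{\pi}\big(f^{(r+2)}(\theta)\big)^2d\theta+\frac1nR_{K;r,2}(\nu_n).$$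
   Context: Circular densities are regarded as $2\pi$-periodic functions on the real line (so continuity and derivatives are understood on the circle) that integrate to one over $[-\pi,\pi)$. A circular kernel family $K_\nu$ is a family of circular densities, symmetric about zero, unimodal and square-integrable, indexed by the smoothing parameter $\nu\in[0,1]$ (the mean resultant length), with convergent Fourier series $$K_\nu(\theta)=\frac1{2\pi}\Big(1+2\sum_{j=1}^\infty\alpha_{K,j}(\nu)\cos(j\theta)\Big),\qquad \alpha_{K,j}(\nu)\in[0,1].$$ Define $$h_K(\nu)=\frac{\pi^2}{3}+4\sum_{j=1}^\infty\frac{(-1)^j\alpha_{K,j}(\nu)}{j^2},$$ $$R_{K;0,2}(\nu)=\frac1{2\pi}\Big(1+2\sum_{j=1}^\infty\alpha_{K,j}^2(\nu)\Big),\qquad R_{K;r,2}(\nu)=\frac1\pi\sum_{j=1}^\infty j^{2r}\alpha_{K,j}^2(\nu)\quad (r\ge1).$$ $\mathrm{MISE}[\hat f^{(r)}_\nu]=\int_{-\pi}^{\pi}\mathbb E\big[(\hat f^{(r)}_\nu(\theta)-f^{(r)}(\theta))^2\big]d\theta$, and $\mathrm{AMISE}$ denotes its asymptotic leading part. Thus the first conclusion says $\mathrm{MISE}[\hat f^{(r)}_{\nu_n}]=O(h_K^2(\nu_n))+O(n^{-1}R_{K;r,2}(\nu_n))$, and the second says that $\mathrm{MISE}[\hat f^{(r)}_{\nu_n}]$ equals the displayed expression up to $o\big(h_K^2(\nu_n)+n^{-1}R_{K;r,2}(\nu_n)\big)$. *)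

theory Defs
  imports
    "HOL-Probability.Probability"
    "HOL-Library.Landau_Symbols"
    "HOL-Library.Periodic_Fun"
begin

text \<open>
  Functions on the circle are \<open>2\<pi>\<close>-periodic functions on the reals, integrated over
  \<open>[-\<pi>, \<pi>)\<close>.  Periodicity makes pointwise continuity and differentiability on the whole real
  line the same as on the circle.
\<close>

definition circular_density :: "(real \<Rightarrow> real) \<Rightarrow> bool" where
  "circular_density g \<longleftrightarrow>
     g \<in> borel_measurable borel \<and> periodic_fun_simple g (2 * pi) \<and> (\<forall>\<theta>. 0 \<le> g \<theta>) \<and>
     set_integrable lborel {-pi..<pi} g \<and> (LINT \<theta>:{-pi..<pi}|lborel. g \<theta>) = 1"

definition circular_square_integrable :: "(real \<Rightarrow> real) \<Rightarrow> bool" where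
  "circular_square_integrable g \<longleftrightarrow>
     set_borel_measurable lborel {-pi..<pi} g \<and>
     set_integrable lborel {-pi..<pi} (\<lambda>\<theta>. (g \<theta>)\<^sup>2)"

text \<open>
  Going once around the circle, \<open>g\<close> increases from an antimode \<open>a\<close> to a mode \<open>m\<close> and then
  decreases back to the antimode.  The monotonicity is weak, so that the uniform density
  (mean resultant length \<open>0\<close>) is unimodal.
\<close>
definition circular_unimodal :: "(real \<Rightarrow> real) \<Rightarrow> bool" where
  "circular_unimodal g \<longleftrightarrow>
     (\<exists>a m. a \<le> m \<and> m \<le> a + 2 * pi \<and> mono_on {a..m} g \<and> antimono_on {m..a + 2 * pi} g)"

text \<open>The modulus of the first trigonometric moment \<open>E (exp (\<i> \<Theta>))\<close>.\<close>
definition mean_resultant_length :: "(real \<Rightarrow> real) \<Rightarrow> real" where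
  "mean_resultant_length g = norm (LINT \<theta>:{-pi..<pi}|lborel. g \<theta> *\<^sub>R cis \<theta>)"

definition times_differentiable :: "nat \<Rightarrow> (real \<Rightarrow> real) \<Rightarrow> bool" where
  "times_differentiable k g \<longleftrightarrow> (\<forall>j<k. \<forall>\<theta>. (deriv ^^ j) g differentiable (at \<theta>))"

text \<open>
  The coefficient \<open>\<alpha>\<^sub>K\<^sub>,\<^sub>j(\<nu>)\<close> of \<open>K\<^sub>\<nu>(\<theta>) = (1 + 2 \<Sum>\<^sub>j \<alpha>\<^sub>K\<^sub>,\<^sub>j(\<nu>) cos (j \<theta>)) / (2\<pi>)\<close>; the sine
  coefficients vanish by symmetry.
\<close>
definition kernel_coeff :: "(real \<Rightarrow> real \<Rightarrow> real) \<Rightarrow> nat \<Rightarrow> real \<Rightarrow> real" where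
  "kernel_coeff K j \<nu> = (LINT \<theta>:{-pi..<pi}|lborel. K \<nu> \<theta> * cos (real j * \<theta>))"

text \<open>
  The index \<open>\<nu> = 1\<close> is left out: a distribution with mean resultant length \<open>1\<close> is a point mass
  and has no density.
\<close>
definition circular_kernel_family :: "(real \<Rightarrow> real \<Rightarrow> real) \<Rightarrow> bool" where
  "circular_kernel_family K \<longleftrightarrow>
     (\<forall>\<nu>\<in>{0..<1}.
        circular_density (K \<nu>) \<and>
        (\<forall>\<theta>. K \<nu> (-\<theta>) = K \<nu> \<theta>) \<and>
        circular_unimodal (K \<nu>) \<and>
        circular_square_integrable (K \<nu>) \<and>
        mean_resultant_length (K \<nu>) = \<nu> \<and>
        (\<forall>j\<ge>1. kernel_coeff K j \<nu> \<in> {0..1}) \<and>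
        (\<forall>\<theta>. summable (\<lambda>j. kernel_coeff K (Suc j) \<nu> * cos (real (Suc j) * \<theta>)) \<and>
             K \<nu> \<theta> = 1 / (2 * pi) *
               (1 + 2 * (\<Sum>j. kernel_coeff K (Suc j) \<nu> * cos (real (Suc j) * \<theta>)))))"

definition h_K :: "(real \<Rightarrow> real \<Rightarrow> real) \<Rightarrow> real \<Rightarrow> real" where
  "h_K K \<nu> = pi\<^sup>2 / 3 + 4 * (\<Sum>j. (-1) ^ Suc j * kernel_coeff K (Suc j) \<nu> / (real (Suc j))\<^sup>2)"

text \<open>
  The functional \<open>R\<^sub>K\<^sub>;\<^sub>r\<^sub>,\<^sub>2(\<nu>)\<close>.  Both series converge when the \<open>r\<close>-th derivative of \<open>K\<^sub>\<nu>\<close> is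
  square-integrable.
\<close>
definition R_K :: "(real \<Rightarrow> real \<Rightarrow> real) \<Rightarrow> nat \<Rightarrow> real \<Rightarrow> real" where
  "R_K K r \<nu> =
     (if r = 0 then 1 / (2 * pi) * (1 + 2 * (\<Sum>j. (kernel_coeff K (Suc j) \<nu>)\<^sup>2))
      else 1 / pi * (\<Sum>j. real (Suc j) ^ (2 * r) * (kernel_coeff K (Suc j) \<nu>)\<^sup>2))"

definition kernel_deriv_estimator ::
  "(real \<Rightarrow> real \<Rightarrow> real) \<Rightarrow> nat \<Rightarrow> (nat \<Rightarrow> 'w \<Rightarrow> real) \<Rightarrow> nat \<Rightarrow> real \<Rightarrow> 'w \<Rightarrow> real \<Rightarrow> real" where
  "kernel_deriv_estimator K r \<Theta> n \<nu> \<omega> \<theta> =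
     1 / real n * (\<Sum>i=1..n. (deriv ^^ r) (K \<nu>) (\<theta> - \<Theta> i \<omega>))"

definition MISE ::
  "'w measure \<Rightarrow> (real \<Rightarrow> real) \<Rightarrow> (real \<Rightarrow> real \<Rightarrow> real) \<Rightarrow> nat \<Rightarrow> (nat \<Rightarrow> 'w \<Rightarrow> real) \<Rightarrow> nat \<Rightarrow> real \<Rightarrow> real"
where
  "MISE M f K r \<Theta> n \<nu> =
     (LINT \<theta>:{-pi..<pi}|lborel.
        (LINT \<omega>|M. (kernel_deriv_estimator K r \<Theta> n \<nu> \<omega> \<theta> - (deriv ^^ r) f \<theta>)\<^sup>2))"

end

theory Submission
  imports Defs
begin

text \<open>
  Write \<open>F\<close> for the \<open>r\<close>-th derivative of \<open>K\<^sub>\<nu>\<close> and \<open>g\<close> for that of \<open>f\<close>.  The estimator is a sample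
  mean with expectation \<open>m = F * f\<close>, which equals \<open>K\<^sub>\<nu> * g\<close> after \<open>r\<close> integrations by parts.  Fubini and
  Parseval (\<open>R\<^sub>K\<^sub>;\<^sub>r\<^sub>,\<^sub>2 = \<integral> F\<^sup>2\<close>) then give the exact identity
  \<open>MISE = \<integral> (m - g)\<^sup>2 + (R\<^sub>K\<^sub>;\<^sub>r\<^sub>,\<^sub>2 - \<integral> m\<^sup>2) / n\<close>, and \<open>\<bar>m\<bar> \<le> sup \<bar>g\<bar>\<close> makes the last term negligible.
  Since \<open>h\<^sub>K\<close> is the second moment of \<open>K\<^sub>\<nu>\<close>, a second-order Taylor expansion of \<open>g\<close> yields
  \<open>m - g = h\<^sub>K g'' / 2 + o(h\<^sub>K)\<close> uniformly: near \<open>0\<close> the error is controlled by the uniform continuity of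
  \<open>g''\<close>, away from \<open>0\<close> by the fourth moment of \<open>K\<^sub>\<nu>\<close>.
\<close>

section \<open>Integration on the circle\<close>

text \<open>The delicate step is Parseval for \<open>F\<close>. The kernel is \<open>r\<close> times
  differentiable everywhere, but its last derivative is merely square-integrable: \<open>F\<close>
  may be discontinuous and its Fourier series need not converge absolutely. The two inequalities
  therefore have different sources: Bessel bounds the series by the integral, and the reverse bound
  is obtained from the derivative of order \<open>r - 1\<close>, whose series does converge
  absolutely. Series manipulations below order \<open>r\<close> start from the sign condition on the
  coefficients, which upgrades convergence at the angle 0 to absolute convergence. All cosines carry
  a phase, so that differentiating just adds \<open>pi / 2\<close> to it and sines need no parallel
  treatment. Because the identity for the MISE is exact, both conclusions follow by estimating its
  two error terms: the squared bias against the square of \<open>h_K\<close>, and the bounded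
  integral of \<open>m\<close> squared against \<open>R_K\<close>, which tends to infinity.\<close>

definition circ :: "real measure" where
  "circ = restrict_space lborel {-pi..<pi}"

lemma space_circ [simp]: "space circ = {-pi..<pi}"
  by (simp add: circ_def space_restrict_space)

lemma measurable_circ [measurable (raw)]:
  "g \<in> measurable borel N \<Longrightarrow> g \<in> measurable circ N"
  unfolding circ_def by (rule measurable_restrict_space1) simp

lemma emeasure_circ: "emeasure circ (space circ) = ennreal (2 * pi)"
  by (simp add: circ_def emeasure_restrict_space space_restrict_space)

lemma measure_circ: "measure circ {-pi..<pi} = 2 * pi"
  using emeasure_circ by (simp add: measure_def)

interpretation circ: finite_measure circ
  by standard (simp only: emeasure_circ, simp)

lemma LINT_circ: "(LINT x:{-pi..<pi}|lborel. g x) = integral\<^sup>L circ g" for g :: "real \<Rightarrow> real"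
  unfolding circ_def set_lebesgue_integral_def by (subst integral_restrict_space) auto

lemma set_integrable_circ: "set_integrable lborel {-pi..<pi} g \<longleftrightarrow> integrable circ g"
  for g :: "real \<Rightarrow> real"
  unfolding circ_def set_integrable_def by (subst integrable_restrict_space) auto

lemma nn_integral_circ: "(\<integral>\<^sup>+x. G x \<partial>circ) = (\<integral>\<^sup>+x. G x * indicator {-pi..<pi} x \<partial>lborel)"
  unfolding circ_def by (subst nn_integral_restrict_space) auto

lemma integrable_circ_bounded:
  fixes g :: "real \<Rightarrow> real"
  assumes "g \<in> borel_measurable borel" "\<And>x. -pi \<le> x \<Longrightarrow> x < pi \<Longrightarrow> \<bar>g x\<bar> \<le> B"
  shows "integrable circ g"
  using assms by (intro circ.integrable_const_bound[where B = B]) auto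

lemma integrable_circ_continuous:
  fixes g :: "real \<Rightarrow> real"
  assumes "continuous_on UNIV g"
  shows "integrable circ g"
proof -
  have "compact (g ` {-pi..pi})"
    using assms by (intro compact_continuous_image) (auto intro: continuous_on_subset)
  then obtain B where "\<And>x. x \<in> {-pi..pi} \<Longrightarrow> norm (g x) \<le> B"
    by (meson bounded_iff compact_imp_bounded image_eqI)
  then show ?thesis
    using assms by (intro integrable_circ_bounded[where B = B])
      (auto intro: borel_measurable_continuous_onI)
qed

section \<open>Invariance of circle integrals under translation and reflection\<close>

lemma nn_integral_circ_shift:
  assumes [measurable]: "G \<in> borel_measurable borel" and per: "\<And>x. G (x + 2 * pi) = G x"
  shows "(\<integral>\<^sup>+x. G (x + s) \<partial>circ) = (\<integral>\<^sup>+x. G x \<partial>circ)"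
proof -
  \<comment> \<open>For a shift within one period, the moved window overhangs by [pi, pi + t).
    Periodicity carries that piece back by \<open>2 * pi\<close>, where it fills the gap [-pi, -pi +
    t). Arbitrary shifts reduce to this case by removing whole periods.\<close>
  have basic: "(\<integral>\<^sup>+x. G (x + t) \<partial>circ) = (\<integral>\<^sup>+x. G x \<partial>circ)" if t: "0 \<le> t" "t < 2 * pi" for t
  proof -
    have "(\<integral>\<^sup>+x. G (x + t) \<partial>circ)
        = (\<integral>\<^sup>+x. G x * indicator {-pi + t..<pi + t} x \<partial>lborel)"
      unfolding nn_integral_circ
      by (subst nn_integral_real_affine[where c = 1 and t = t and f = "\<lambda>x. G x * indicator {-pi + t..<pi + t} x"])
         (auto intro!: nn_integral_cong simp: indicator_def algebra_simps)
    also have "\<dots> = (\<integral>\<^sup>+x. G x * indicator {-pi + t..<pi} x + G x * indicator {pi..<pi + t} x \<partial>lborel)"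
      using t by (intro nn_integral_cong) (auto simp: indicator_def)
    also have "\<dots> = (\<integral>\<^sup>+x. G x * indicator {-pi + t..<pi} x \<partial>lborel)
        + (\<integral>\<^sup>+x. G x * indicator {pi..<pi + t} x \<partial>lborel)"
      by (rule nn_integral_add) auto
    also have "(\<integral>\<^sup>+x. G x * indicator {pi..<pi + t} x \<partial>lborel)
        = (\<integral>\<^sup>+x. G x * indicator {-pi..<-pi + t} x \<partial>lborel)"
      by (subst nn_integral_real_affine[where c = 1 and t = "2 * pi"])
         (auto intro!: nn_integral_cong simp: indicator_def per add.commute[of "2 * pi"])
    also have "(\<integral>\<^sup>+x. G x * indicator {-pi + t..<pi} x \<partial>lborel) + \<dots>
        = (\<integral>\<^sup>+x. G x * indicator {-pi + t..<pi} x + G x * indicator {-pi..<-pi + t} x \<partial>lborel)"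
      by (rule nn_integral_add[symmetric]) auto
    also have "\<dots> = (\<integral>\<^sup>+x. G x \<partial>circ)"
      unfolding nn_integral_circ using t by (intro nn_integral_cong) (auto simp: indicator_def)
    finally show ?thesis .
  qed
  interpret periodic_fun_simple G "2 * pi" by standard (rule per)
  define k where "k = \<lfloor>s / (2 * pi)\<rfloor>"
  define t where "t = s - of_int k * (2 * pi)"
  have "of_int k \<le> s / (2 * pi)" "s / (2 * pi) < of_int k + 1"
    unfolding k_def by linarith+
  then have "0 \<le> t" "t < 2 * pi"
    unfolding t_def by (auto simp: field_simps)
  moreover have "G (x + s) = G (x + t)" for x
    using plus_of_int[of "x + t" k] by (simp add: t_def)
  ultimately show ?thesis using basic by simp
qed

text \<open>Reflection turns the window into (-pi, pi], which differs from [-pi, pi) only in the two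
  endpoints, a null set.\<close>

lemma nn_integral_circ_reflect:
  assumes [measurable]: "G \<in> borel_measurable borel"
  shows "(\<integral>\<^sup>+x. G (- x) \<partial>circ) = (\<integral>\<^sup>+x. G x \<partial>circ)"
proof -
  have "(\<integral>\<^sup>+x. G (- x) \<partial>circ) = (\<integral>\<^sup>+x. G x * indicator {-pi<..pi} x \<partial>lborel)"
    unfolding nn_integral_circ
    by (subst nn_integral_real_affine[where c = "-1" and t = 0 and f = "\<lambda>x. G x * indicator {-pi<..pi} x"])
       (auto intro!: nn_integral_cong simp: indicator_def)
  also have "\<dots> = (\<integral>\<^sup>+x. G x \<partial>circ)"
    unfolding nn_integral_circ
  proof (rule nn_integral_cong_AE)
    have "AE x in lborel. x \<noteq> pi \<and> x \<noteq> -pi"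
      using AE_lborel_singleton[of pi] AE_lborel_singleton[of "-pi"] by eventually_elim auto
    then show "AE x in lborel. G x * indicator {-pi<..pi} x = G x * indicator {-pi..<pi} x"
      by eventually_elim (auto simp: indicator_def)
  qed
  finally show ?thesis .
qed

text \<open>Passes invariance from nonnegative integrals, which need no integrability, to signed
  ones. Since \<open>ennreal\<close> truncates negative reals to 0, the choices
  \<open>ennreal x\<close> and \<open>ennreal (- x)\<close> of \<open>\<phi>\<close> give the
  positive and negative parts. In the non-integrable case both integrals are 0 by
  convention.\<close>

lemma integral_eq_of_nn_integral:
  fixes g h :: "real \<Rightarrow> real"
  assumes [measurable]: "g \<in> borel_measurable M" "h \<in> borel_measurable N"
    and eq: "\<And>\<phi> :: real \<Rightarrow> ennreal. \<phi> \<in> borel_measurable borel \<Longrightarrow>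
      (\<integral>\<^sup>+x. \<phi> (g x) \<partial>M) = (\<integral>\<^sup>+x. \<phi> (h x) \<partial>N)"
  shows "integrable M g \<longleftrightarrow> integrable N h" and "integral\<^sup>L M g = integral\<^sup>L N h"
proof -
  have nn: "(\<integral>\<^sup>+x. ennreal (norm (g x)) \<partial>M) = (\<integral>\<^sup>+x. ennreal (norm (h x)) \<partial>N)"
    by (rule eq[of "\<lambda>x. ennreal (norm x)"]) simp
  then show I: "integrable M g \<longleftrightarrow> integrable N h"
    by (simp add: integrable_iff_bounded)
  show "integral\<^sup>L M g = integral\<^sup>L N h"
  proof (cases "integrable M g")
    case True
    then show ?thesis
      using I eq[of "\<lambda>x. ennreal x"] eq[of "\<lambda>x. ennreal (- x)"]
      by (simp add: real_lebesgue_integral_def)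
  next
    case False
    with I show ?thesis by (simp add: not_integrable_integral_eq)
  qed
qed

lemma
  fixes g :: "real \<Rightarrow> real"
  assumes [measurable]: "g \<in> borel_measurable borel" and per: "\<And>x. g (x + 2 * pi) = g x"
  shows integral_circ_shift: "integral\<^sup>L circ (\<lambda>x. g (x + s)) = integral\<^sup>L circ g"
    and integrable_circ_shift: "integrable circ (\<lambda>x. g (x + s)) \<longleftrightarrow> integrable circ g"
proof -
  have "(\<integral>\<^sup>+x. \<phi> (g (x + s)) \<partial>circ) = (\<integral>\<^sup>+x. \<phi> (g x) \<partial>circ)"
    if [measurable]: "\<phi> \<in> borel_measurable borel" for \<phi> :: "real \<Rightarrow> ennreal"
    by (rule nn_integral_circ_shift) (auto simp: per)
  then show "integral\<^sup>L circ (\<lambda>x. g (x + s)) = integral\<^sup>L circ g"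
    "integrable circ (\<lambda>x. g (x + s)) \<longleftrightarrow> integrable circ g"
    by (simp_all add: integral_eq_of_nn_integral[of "\<lambda>x. g (x + s)" circ g circ])
qed

lemma
  fixes g :: "real \<Rightarrow> real"
  assumes [measurable]: "g \<in> borel_measurable borel"
  shows integral_circ_reflect: "integral\<^sup>L circ (\<lambda>x. g (- x)) = integral\<^sup>L circ g"
    and integrable_circ_reflect: "integrable circ (\<lambda>x. g (- x)) \<longleftrightarrow> integrable circ g"
proof -
  have "(\<integral>\<^sup>+x. \<phi> (g (- x)) \<partial>circ) = (\<integral>\<^sup>+x. \<phi> (g x) \<partial>circ)"
    if [measurable]: "\<phi> \<in> borel_measurable borel" for \<phi> :: "real \<Rightarrow> ennreal"
    by (rule nn_integral_circ_reflect) auto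
  then show "integral\<^sup>L circ (\<lambda>x. g (- x)) = integral\<^sup>L circ g"
    "integrable circ (\<lambda>x. g (- x)) \<longleftrightarrow> integrable circ g"
    by (simp_all add: integral_eq_of_nn_integral[of "\<lambda>x. g (- x)" circ g circ])
qed

lemma
  fixes g :: "real \<Rightarrow> real"
  assumes [measurable]: "g \<in> borel_measurable borel" and per: "\<And>x. g (x + 2 * pi) = g x"
  shows integral_circ_reflect_shift: "integral\<^sup>L circ (\<lambda>x. g (s - x)) = integral\<^sup>L circ g"
    and integrable_circ_reflect_shift: "integrable circ (\<lambda>x. g (s - x)) \<longleftrightarrow> integrable circ g"
  using integral_circ_reflect[of "\<lambda>x. g (x + s)"] integral_circ_shift[OF assms]
    integrable_circ_reflect[of "\<lambda>x. g (x + s)"] integrable_circ_shift[OF assms]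
  by simp_all

section \<open>The fundamental theorem of calculus and integration by parts\<close>

lemma circ_integrable_Icc:
  fixes g :: "real \<Rightarrow> real"
  assumes "integrable circ g"
  shows "set_integrable lborel {-pi..pi} g" "(LINT x:{-pi..pi}|lborel. g x) = integral\<^sup>L circ g"
proof -
  have I: "set_integrable lborel {-pi..<pi} g" using assms by (simp add: set_integrable_circ)
  have E: "{-pi..pi} = {-pi..<pi} \<union> {pi}" by auto
  have "integrable lborel (\<lambda>x. indicat_real {pi} x *\<^sub>R g pi)"
    by (intro integrable_scaleR_left integrable_real_indicator) auto
  moreover have "(\<lambda>x. indicat_real {pi} x *\<^sub>R g pi) = (\<lambda>x. indicat_real {pi} x *\<^sub>R g x)"
    by (auto simp: indicator_def)
  ultimately have S: "set_integrable lborel {pi} g"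
    unfolding set_integrable_def by metis
  show "set_integrable lborel {-pi..pi} g"
    unfolding E by (rule set_integrable_Un[OF I S]) auto
  show "(LINT x:{-pi..pi}|lborel. g x) = integral\<^sup>L circ g"
  proof -
    have "(LINT x:{-pi..pi}|lborel. g x) = (LINT x:{-pi..<pi}|lborel. g x) + (LINT x:{pi}|lborel. g x)"
      unfolding E by (rule set_integral_Un[OF _ I S]) auto
    also have "(LINT x:{pi}|lborel. g x) = 0"
      unfolding set_lebesgue_integral_def
      by (rule integral_eq_zero_AE, rule eventually_mono[OF AE_lborel_singleton[of pi]]) auto
    finally show ?thesis by (simp add: LINT_circ)
  qed
qed

text \<open>Everywhere differentiable functions may have discontinuous derivatives, so the fundamental
  theorem of calculus is taken from the Henstock--Kurzweil integral.\<close>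
lemma integral_circ_deriv:
  fixes g g' :: "real \<Rightarrow> real"
  assumes "\<And>x. (g has_real_derivative g' x) (at x)" "integrable circ g'"
  shows "integral\<^sup>L circ g' = g pi - g (-pi)"
proof -
  have "(g' has_integral (g pi - g (-pi))) {-pi..pi}"
    using assms(1) by (intro fundamental_theorem_of_calculus)
      (auto simp: has_real_derivative_iff_has_vector_derivative[symmetric] intro: has_field_derivative_at_within)
  moreover have "integral\<^sup>L circ g' = integral {-pi..pi} g'"
    using set_borel_integral_eq_integral(2)[OF circ_integrable_Icc(1)[OF assms(2)]]
      circ_integrable_Icc(2)[OF assms(2)] by simp
  ultimately show ?thesis by (simp add: integral_unique)
qed

lemma integral_circ_by_parts:
  fixes u v u' v' :: "real \<Rightarrow> real"
  assumes "\<And>x. (u has_real_derivative u' x) (at x)" "\<And>x. (v has_real_derivative v' x) (at x)"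
    and "integrable circ (\<lambda>x. u' x * v x)" "integrable circ (\<lambda>x. u x * v' x)"
    and "u pi * v pi = u (-pi) * v (-pi)"
  shows "integral\<^sup>L circ (\<lambda>x. u' x * v x) = - integral\<^sup>L circ (\<lambda>x. u x * v' x)"
proof -
  have "integral\<^sup>L circ (\<lambda>x. u' x * v x + u x * v' x) = u pi * v pi - u (-pi) * v (-pi)"
    by (rule integral_circ_deriv[where g = "\<lambda>x. u x * v x"])
       (auto intro!: derivative_eq_intros assms Bochner_Integration.integrable_add)
  then show ?thesis using assms by simp
qed

section \<open>Iterated derivatives: periodicity, continuity, measurability\<close>

lemma deriv_shift_arg: "deriv (\<lambda>x. g (x + p)) x = deriv g (x + p)" for g :: "real \<Rightarrow> real"
  unfolding deriv_def by (simp add: DERIV_shift)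

text \<open>\<open>deriv\<close> chooses from the derivative predicate, and that predicate is
  translation invariant; so periodicity survives every iteration, including at points where no
  derivative exists.\<close>

lemma periodic_deriv_funpow:
  fixes g :: "real \<Rightarrow> real"
  assumes "\<And>x. g (x + p) = g x"
  shows "(deriv ^^ k) g (x + p) = (deriv ^^ k) g x"
proof (induction k arbitrary: x)
  case (Suc k)
  then have "(\<lambda>x. (deriv ^^ k) g (x + p)) = (deriv ^^ k) g" by auto
  then show ?case using deriv_shift_arg[of "(deriv ^^ k) g" p x] by simp
qed (use assms in auto)

lemma times_differentiable_DERIV:
  assumes "times_differentiable k g" "j < k"
  shows "((deriv ^^ j) g has_real_derivative (deriv ^^ Suc j) g x) (at x)"
  using assms by (auto simp: times_differentiable_def DERIV_deriv_iff_real_differentiable)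

lemma times_differentiable_continuous:
  assumes "times_differentiable k g" "j < k"
  shows "continuous_on UNIV ((deriv ^^ j) g)"
  using times_differentiable_DERIV[OF assms]
  by (intro continuous_at_imp_continuous_on ballI DERIV_isCont)

text \<open>A derivative may be discontinuous, but it is a pointwise limit of difference quotients
  of a continuous function.\<close>

lemma borel_measurable_DERIV:
  fixes g g' :: "real \<Rightarrow> real"
  assumes "\<And>x. (g has_real_derivative g' x) (at x)"
  shows "g' \<in> borel_measurable borel"
proof (rule borel_measurable_LIMSEQ_real)
  have [measurable]: "g \<in> borel_measurable borel"
    by (rule borel_measurable_continuous_onI)
       (use assms in \<open>auto intro!: continuous_at_imp_continuous_on DERIV_isCont\<close>)
  show "(\<lambda>x. (g (x + inverse (real (Suc n))) - g x) / inverse (real (Suc n))) \<in> borel_measurable borel" for n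
    by measurable
  fix x
  have "((\<lambda>h. (g (x + h) - g x) / h) \<longlongrightarrow> g' x) (at 0)"
    using assms by (simp add: DERIV_def)
  moreover have "filterlim (\<lambda>n. inverse (real (Suc n))) (at 0) sequentially"
    by (rule filterlim_atI) (use LIMSEQ_inverse_real_of_nat in auto)
  ultimately show "(\<lambda>n. (g (x + inverse (real (Suc n))) - g x) / inverse (real (Suc n))) \<longlonglongrightarrow> g' x"
    by (rule filterlim_compose)
qed

lemma borel_measurable_deriv_funpow:
  assumes "times_differentiable k g" "g \<in> borel_measurable borel"
  shows "(deriv ^^ k) g \<in> borel_measurable borel"
proof (cases k)
  case (Suc j)
  show ?thesis unfolding Suc
    using assms Suc by (intro borel_measurable_DERIV[OF times_differentiable_DERIV]) auto
qed (use assms in simp)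

section \<open>Cosine series\<close>

text \<open>Frequencies stay in the form \<open>real (Suc j)\<close>, so that the series in
  different lemmas match syntactically.\<close>

declare of_nat_Suc [simp del]

text \<open>The frequency is an integer because it will be a difference of two natural frequencies,
  of either sign.\<close>

lemma integral_circ_cos_eq_0:
  fixes k :: int
  assumes "k \<noteq> 0"
  shows "integral\<^sup>L circ (\<lambda>x. cos (of_int k * x + c)) = 0"
proof -
  have "integral\<^sup>L circ (\<lambda>x. cos (of_int k * x + c))
      = sin (of_int k * pi + c) / of_int k - sin (of_int k * (- pi) + c) / of_int k"
    using assms
    by (intro integral_circ_deriv[where g = "\<lambda>x. sin (of_int k * x + c) / of_int k"])
       (auto intro!: derivative_eq_intros integrable_circ_continuous continuous_intros)
  also have "sin (of_int k * pi) = 0"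
    by (simp add: sin_times_pi_eq_0)
  then have "sin (of_int k * pi + c) / of_int k - sin (of_int k * (- pi) + c) / of_int k = 0"
    by (simp add: sin_add sin_diff)
  finally show ?thesis .
qed

lemma integral_circ_const: "integral\<^sup>L circ (\<lambda>x. c) = 2 * pi * c" for c :: real
  by (simp add: measure_circ)

text \<open>The product-to-sum formula leaves the frequencies \<open>i - j\<close> and
  \<open>i + j + 2\<close>; the second is never zero, the first only on the diagonal.\<close>

lemma integral_circ_cos_cos:
  "integral\<^sup>L circ (\<lambda>x. cos (real (Suc i) * x + c) * cos (real (Suc j) * x + c)) = (if i = j then pi else 0)"
proof -
  have "integral\<^sup>L circ (\<lambda>x. cos (real (Suc i) * x + c) * cos (real (Suc j) * x + c))
      = integral\<^sup>L circ (\<lambda>x. cos (of_int (int i - int j) * x + 0) / 2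
          + cos (of_int (int i + int j + 2) * x + 2 * c) / 2)"
    by (intro Bochner_Integration.integral_cong refl) (simp add: cos_times_cos algebra_simps add_divide_distrib of_nat_Suc)
  also have "\<dots> = integral\<^sup>L circ (\<lambda>x. cos (of_int (int i - int j) * x + 0)) / 2
          + integral\<^sup>L circ (\<lambda>x. cos (of_int (int i + int j + 2) * x + 2 * c)) / 2"
    by (subst Bochner_Integration.integral_add) (auto intro!: integrable_circ_continuous continuous_intros)
  also have "integral\<^sup>L circ (\<lambda>x. cos (of_int (int i + int j + 2) * x + 2 * c)) = 0"
    by (rule integral_circ_cos_eq_0) linarith
  also have "integral\<^sup>L circ (\<lambda>x. cos (of_int (int i - int j) * x + 0)) = (if i = j then 2 * pi else 0)"
    using integral_circ_cos_eq_0[of "int i - int j" 0] by (simp add: measure_circ)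
  finally show ?thesis by (auto split: if_splits)
qed

lemma integral_circ_square: "integral\<^sup>L circ (\<lambda>x. x\<^sup>2) = 2 * pi ^ 3 / 3"
proof -
  have "integral\<^sup>L circ (\<lambda>x. x\<^sup>2) = pi ^ 3 / 3 - (- pi) ^ 3 / 3"
    by (intro integral_circ_deriv[where g = "\<lambda>x. x ^ 3 / 3"])
       (auto intro!: derivative_eq_intros integrable_circ_continuous continuous_intros)
  then show ?thesis by simp
qed

lemma integral_circ_square_cos:
  "integral\<^sup>L circ (\<lambda>x. cos (real (Suc j) * x) * x\<^sup>2) = 4 * pi * (-1) ^ Suc j / (real (Suc j))\<^sup>2"
proof -
  define m where "m = real (Suc j)"
  have [simp]: "m \<noteq> 0" by (simp add: m_def)
  \<comment> \<open>This antiderivative comes from integrating by parts twice. At \<open>pi\<close>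
    and \<open>- pi\<close> the sines vanish and only the middle term survives.\<close>
  define g where "g x = x\<^sup>2 * sin (m * x) / m + 2 * x * cos (m * x) / m\<^sup>2 - 2 * sin (m * x) / m ^ 3" for x
  have "integral\<^sup>L circ (\<lambda>x. cos (m * x) * x\<^sup>2) = g pi - g (- pi)"
  proof (rule integral_circ_deriv)
    show "integrable circ (\<lambda>x. cos (m * x) * x\<^sup>2)"
      by (intro integrable_circ_continuous continuous_intros)
    show "(g has_real_derivative cos (m * x) * x\<^sup>2) (at x)" for x
      unfolding g_def
      by (auto intro!: derivative_eq_intros simp: field_simps power2_eq_square power3_eq_cube)
  qed
  also have "sin (m * pi) = 0" "cos (m * pi) = (-1) ^ Suc j"
    unfolding m_def by (simp_all only: sin_npi cos_npi)
  then have "g pi - g (- pi) = 4 * pi * (-1) ^ Suc j / m\<^sup>2"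
    by (simp add: g_def)
  finally show ?thesis by (simp add: m_def)
qed

text \<open>The terms are dominated by \<open>\<bar>a j\<bar> * \<bar>w x\<bar>\<close>, so their
  integrals are absolutely summable and sum and integral can be exchanged. The weight
  \<open>w\<close> will be a square, a single cosine, the constant 1, or the series itself.\<close>

lemma
  fixes a :: "nat \<Rightarrow> real" and w :: "real \<Rightarrow> real"
  assumes a: "summable (\<lambda>j. \<bar>a j\<bar>)" and w: "integrable circ w"
  shows integrable_cos_series: "integrable circ (\<lambda>x. (\<Sum>j. a j * cos (real (Suc j) * x + c)) * w x)"
    and integral_cos_series: "(\<lambda>j. a j * integral\<^sup>L circ (\<lambda>x. cos (real (Suc j) * x + c) * w x))
      sums integral\<^sup>L circ (\<lambda>x. (\<Sum>j. a j * cos (real (Suc j) * x + c)) * w x)"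
proof -
  define f where "f j x = a j * (cos (real (Suc j) * x + c) * w x)" for j x
  have [measurable]: "w \<in> borel_measurable circ" using w by auto
  have cosw: "integrable circ (\<lambda>x. cos (real (Suc j) * x + c) * w x)" for j
    by (rule Bochner_Integration.integrable_bound[OF w])
      (auto simp: abs_mult mult_left_le_one_le abs_cos_le_one intro!: AE_I2)
  then have int: "integrable circ (f j)" for j
    unfolding f_def by (intro integrable_mult_right)
  have bd: "norm (f j x) \<le> \<bar>a j\<bar> * \<bar>w x\<bar>" for j x
    unfolding f_def by (auto simp: abs_mult intro!: mult_left_mono mult_left_le_one_le)
  have sm: "summable (\<lambda>j. norm (f j x))" for x
    by (rule summable_comparison_test[OF _ summable_mult2[OF a, of "\<bar>w x\<bar>"]]) (use bd in auto)
  have "(\<integral>x. norm (f j x) \<partial>circ) \<le> \<bar>a j\<bar> * (\<integral>x. \<bar>w x\<bar> \<partial>circ)" for j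
    using w by (subst integral_mult_right_zero[symmetric]) (intro integral_mono bd integrable_norm int integrable_mult_right, auto)
  then have sm2: "summable (\<lambda>j. \<integral>x. norm (f j x) \<partial>circ)"
    by (intro summable_comparison_test[OF _ summable_mult2[OF a, of "\<integral>x. \<bar>w x\<bar> \<partial>circ"]])
       (auto simp: integral_nonneg_AE)
  have smc: "summable (\<lambda>j. a j * cos (real (Suc j) * x + c))" for x
    by (rule summable_comparison_test[OF _ a]) (auto simp: abs_mult intro!: mult_left_le)
  have eq: "(\<Sum>j. f j x) = (\<Sum>j. a j * cos (real (Suc j) * x + c)) * w x" for x
    using suminf_mult2[OF smc[of x], of "w x"] by (simp add: f_def mult.assoc)
  show "integrable circ (\<lambda>x. (\<Sum>j. a j * cos (real (Suc j) * x + c)) * w x)"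
    unfolding eq[symmetric] using int sm sm2 by (intro integrable_suminf) auto
  show "(\<lambda>j. a j * integral\<^sup>L circ (\<lambda>x. cos (real (Suc j) * x + c) * w x))
      sums integral\<^sup>L circ (\<lambda>x. (\<Sum>j. a j * cos (real (Suc j) * x + c)) * w x)"
    using sums_integral[OF int _ sm2] sm unfolding eq by (simp add: f_def)
qed

lemma continuous_cos_series:
  fixes a :: "nat \<Rightarrow> real"
  assumes "summable (\<lambda>j. \<bar>a j\<bar>)"
  shows "continuous_on UNIV (\<lambda>x. \<Sum>j. a j * cos (real (Suc j) * x + c))"
proof (rule uniform_limit_theorem)
  show "uniform_limit UNIV (\<lambda>n x. \<Sum>j<n. a j * cos (real (Suc j) * x + c))
      (\<lambda>x. \<Sum>j. a j * cos (real (Suc j) * x + c)) sequentially"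
    by (rule Weierstrass_m_test[OF _ assms]) (auto simp: abs_mult intro!: mult_left_le)
qed (auto intro!: always_eventually continuous_intros)

text \<open>Writing the derivative with the phase \<open>c + pi / 2\<close> instead of a sine keeps
  the result in the same shape, so the lemma can be iterated.\<close>

lemma DERIV_cos_series:
  fixes a :: "nat \<Rightarrow> real"
  assumes "summable (\<lambda>j. real (Suc j) * \<bar>a j\<bar>)"
  shows "((\<lambda>x. \<Sum>j. a j * cos (real (Suc j) * x + c)) has_real_derivative
    (\<Sum>j. (real (Suc j) * a j) * cos (real (Suc j) * x + (c + pi / 2)))) (at x)"
proof -
  let ?f = "\<lambda>j x. a j * cos (real (Suc j) * x + c)"
  let ?f' = "\<lambda>j x. (real (Suc j) * a j) * cos (real (Suc j) * x + (c + pi / 2))"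
  have *: "cos (y + (c + pi / 2)) = - sin (y + c)" for y
    by (simp add: cos_add sin_add)
  have 1: "(?f j has_real_derivative ?f' j x) (at x within UNIV)" for j x
    unfolding * by (auto intro!: derivative_eq_intros)
  have 2: "uniformly_convergent_on UNIV (\<lambda>n x. \<Sum>j<n. ?f' j x)"
    unfolding uniformly_convergent_on_def
    by (intro exI, rule Weierstrass_m_test[OF _ assms]) (auto simp: abs_mult intro!: mult_left_le)
  have "summable (\<lambda>j. \<bar>a j\<bar>)"
    by (rule summable_comparison_test[OF _ assms]) (auto intro!: exI[of _ 0] mult_right_mono simp: of_nat_Suc algebra_simps)
  then have 3: "summable (\<lambda>j. ?f j 0)"
    by (rule summable_comparison_test[rotated]) (auto simp: abs_mult intro!: mult_left_le)
  show ?thesis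
    using has_field_derivative_series'(2)[OF convex_UNIV 1 2 UNIV_I 3, of x] by simp
qed

text \<open>Termwise integration is used twice: against a single cosine it isolates
  \<open>pi * a i\<close>, and against the series itself it sums these values into the square
  integral.\<close>

lemma parseval_cos_series:
  fixes a :: "nat \<Rightarrow> real"
  assumes a: "summable (\<lambda>j. \<bar>a j\<bar>)"
  shows "(\<lambda>j. pi * (a j)\<^sup>2) sums integral\<^sup>L circ (\<lambda>x. (\<Sum>j. a j * cos (real (Suc j) * x + c))\<^sup>2)"
    and "integral\<^sup>L circ (\<lambda>x. \<Sum>j. a j * cos (real (Suc j) * x + c)) = 0"
proof -
  let ?G = "\<lambda>x. \<Sum>j. a j * cos (real (Suc j) * x + c)"
  have "integral\<^sup>L circ (\<lambda>x. cos (real (Suc i) * x + c) * ?G x) = pi * a i" for i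
  proof -
    have "(\<lambda>j. a j * (if j = i then pi else 0)) sums
        integral\<^sup>L circ (\<lambda>x. cos (real (Suc i) * x + c) * ?G x)"
      using integral_cos_series[OF a, of "\<lambda>x. cos (real (Suc i) * x + c)" c]
      by (simp add: integral_circ_cos_cos mult.commute[of _ "cos (real (Suc i) * x + c)" for x]
        integrable_circ_continuous continuous_intros eq_commute[of i])
    moreover have "(\<lambda>j. a j * (if j = i then pi else 0)) sums (pi * a i)"
      using sums_single[of i "\<lambda>j. a j * pi"] by (simp add: if_distrib mult.commute cong: if_cong)
    ultimately show ?thesis by (rule sums_unique2)
  qed
  moreover have "integrable circ ?G"
    by (rule integrable_circ_continuous[OF continuous_cos_series[OF a]])
  ultimately show "(\<lambda>j. pi * (a j)\<^sup>2) sums integral\<^sup>L circ (\<lambda>x. (?G x)\<^sup>2)"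
    using integral_cos_series[OF a, of ?G c] by (simp add: power2_eq_square mult.left_commute)
  have "(\<lambda>j. 0) sums integral\<^sup>L circ ?G"
    using integral_cos_series[OF a, of "\<lambda>_. 1" c] integral_circ_cos_eq_0[of "int (Suc j)" c for j]
    by simp
  then show "integral\<^sup>L circ ?G = 0" using sums_unique2 sums_zero by blast
qed

section \<open>Bessel's inequality, and the reverse bound for derivatives\<close>

lemma integrable_circ_mult_cos:
  assumes "integrable circ (w :: real \<Rightarrow> real)"
  shows "integrable circ (\<lambda>x. w x * cos (m * x + c))"
  by (rule Bochner_Integration.integrable_bound[OF assms])
    (use assms in \<open>auto simp: abs_mult intro!: AE_I2 mult_left_le\<close>)

lemma integrable_circ_of_square:
  fixes w :: "real \<Rightarrow> real"
  assumes "w \<in> borel_measurable circ" "integrable circ (\<lambda>x. (w x)\<^sup>2)"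
  shows "integrable circ w"
proof (rule Bochner_Integration.integrable_bound)
  show "integrable circ (\<lambda>x. 1 + (w x)\<^sup>2)" using assms by auto
  have "\<bar>y\<bar> \<le> 1 + y\<^sup>2" for y :: real
    using sum_squares_bound[of 1 "\<bar>y\<bar>"] by (simp add: power2_abs)
  then show "AE x in circ. norm (w x) \<le> norm (1 + (w x)\<^sup>2)" by (auto intro!: AE_I2)
qed (rule assms)

text \<open>The squared distance from \<open>w\<close> to the projection \<open>?P\<close> is
  nonnegative, which bounds each partial sum. The \<open>b j\<close> are unnormalised: a cosine has
  square integral \<open>pi\<close>, hence the projection has coefficients
  \<open>b j / pi\<close>.\<close>

lemma bessel_cos:
  fixes w :: "real \<Rightarrow> real" and b :: "nat \<Rightarrow> real"
  assumes [measurable]: "w \<in> borel_measurable circ" and w2: "integrable circ (\<lambda>x. (w x)\<^sup>2)"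
    and b: "\<And>j. integral\<^sup>L circ (\<lambda>x. w x * cos (real (Suc j) * x + c)) = b j"
  shows "summable (\<lambda>j. (b j)\<^sup>2)" and "(\<Sum>j. (b j)\<^sup>2) \<le> pi * integral\<^sup>L circ (\<lambda>x. (w x)\<^sup>2)"
proof -
  note w = integrable_circ_of_square[OF assms(1,2)]
  let ?e = "\<lambda>j x. cos (real (Suc j) * x + c)"
  have partial: "(\<Sum>j<n. (b j)\<^sup>2) \<le> pi * integral\<^sup>L circ (\<lambda>x. (w x)\<^sup>2)" for n
  proof -
    let ?P = "\<lambda>x. \<Sum>j<n. b j / pi * ?e j x"
    have "integral\<^sup>L circ (\<lambda>x. w x * ?P x) = integral\<^sup>L circ (\<lambda>x. \<Sum>j<n. b j / pi * (w x * ?e j x))"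
      by (simp add: sum_distrib_left mult_ac)
    also have "\<dots> = (\<Sum>j<n. b j / pi * b j)"
      using integrable_circ_mult_cos[OF w] by (subst Bochner_Integration.integral_sum) (auto simp: b)
    finally have wP: "integral\<^sup>L circ (\<lambda>x. w x * ?P x) = (\<Sum>j<n. (b j)\<^sup>2) / pi"
      by (simp add: power2_eq_square sum_divide_distrib)
    have "integral\<^sup>L circ (\<lambda>x. ?P x * ?P x)
        = integral\<^sup>L circ (\<lambda>x. \<Sum>i<n. \<Sum>j<n. b i / pi * (b j / pi) * (?e i x * ?e j x))"
      by (simp add: sum_product mult_ac)
    also have "\<dots> = (\<Sum>i<n. \<Sum>j<n. b i / pi * (b j / pi) * integral\<^sup>L circ (\<lambda>x. ?e i x * ?e j x))"
      by (subst Bochner_Integration.integral_sum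
          | (auto intro!: integrable_circ_continuous continuous_intros sum.cong)[1])+
    also have "\<dots> = (\<Sum>i<n. \<Sum>j<n. b i / pi * (b j / pi) * (if i = j then pi else 0))"
      by (simp only: integral_circ_cos_cos)
    also have "\<dots> = (\<Sum>j<n. (b j)\<^sup>2) / pi"
      by (simp add: if_distrib sum_divide_distrib power2_eq_square cong: if_cong)
    finally have PP: "integral\<^sup>L circ (\<lambda>x. ?P x * ?P x) = (\<Sum>j<n. (b j)\<^sup>2) / pi" .
    have iP: "integrable circ (\<lambda>x. ?P x * ?P x)"
      by (intro integrable_circ_continuous continuous_intros)
    have iwP: "integrable circ (\<lambda>x. w x * ?P x)"
      unfolding sum_distrib_left
      using integrable_circ_mult_cos[OF w]
      by (intro Bochner_Integration.integrable_sum) (auto simp: mult.left_commute[of "w _"])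
    have "0 \<le> integral\<^sup>L circ (\<lambda>x. (w x - ?P x)\<^sup>2)" by simp
    also have "\<dots> = integral\<^sup>L circ (\<lambda>x. ((w x)\<^sup>2 - 2 * (w x * ?P x)) + ?P x * ?P x)"
      by (simp add: power2_eq_square algebra_simps)
    also have "\<dots> = integral\<^sup>L circ (\<lambda>x. (w x)\<^sup>2) - 2 * ((\<Sum>j<n. (b j)\<^sup>2) / pi) + (\<Sum>j<n. (b j)\<^sup>2) / pi"
      using w2 iP iwP
      by (simp only: Bochner_Integration.integral_add Bochner_Integration.integral_diff
        integrable_mult_right integral_mult_right_zero Bochner_Integration.integrable_diff wP PP)
    finally show ?thesis by (simp add: field_simps)
  qed
  show *: "summable (\<lambda>j. (b j)\<^sup>2)"
    by (rule summableI_nonneg_bounded[OF _ partial]) auto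
  show "(\<Sum>j. (b j)\<^sup>2) \<le> pi * integral\<^sup>L circ (\<lambda>x. (w x)\<^sup>2)"
    by (rule suminf_le_const[OF * partial])
qed

text \<open>Parseval for the symmetric difference quotients, whose series converges absolutely, passes
  to the derivative by Fatou's lemma.\<close>
lemma integral_square_deriv_le:
  fixes b :: "nat \<Rightarrow> real"
  assumes H: "\<And>x. H x = d + (\<Sum>j. b j * cos (real (Suc j) * x + c))"
    and b: "summable (\<lambda>j. \<bar>b j\<bar>)" and b2: "summable (\<lambda>j. (real (Suc j) * b j)\<^sup>2)"
    and F: "\<And>x. (H has_real_derivative F x) (at x)" and F2: "integrable circ (\<lambda>x. (F x)\<^sup>2)"
  shows "integral\<^sup>L circ (\<lambda>x. (F x)\<^sup>2) \<le> pi * (\<Sum>j. (real (Suc j) * b j)\<^sup>2)"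
proof -
  define s where "s n = inverse (real (Suc n))" for n
  \<comment> \<open>A symmetric quotient keeps a single phase: cos (y + z) - cos (y - z) = 2 sin z
    cos (y + pi / 2), so each coefficient is multiplied by
    \<open>sin (real (Suc j) * s n) / s n\<close>, the phase grows by \<open>pi / 2\<close>, and
    \<open>d\<close> cancels.\<close>
  define q where "q n x = (H (x + s n) - H (x - s n)) / (2 * s n)" for n x
  let ?B = "pi * (\<Sum>j. (real (Suc j) * b j)\<^sup>2)"
  have s0: "s n > 0" for n by (simp add: s_def)
  have [measurable]: "H \<in> borel_measurable borel"
    by (rule borel_measurable_continuous_onI)
       (use F in \<open>auto intro!: continuous_at_imp_continuous_on DERIV_isCont\<close>)
  have [measurable]: "F \<in> borel_measurable borel" by (rule borel_measurable_DERIV[OF F])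
  have smH: "summable (\<lambda>j. b j * cos (real (Suc j) * x + c))" for x
    by (rule summable_comparison_test[OF _ b]) (auto simp: abs_mult intro!: mult_left_le)
  have q_bound: "integrable circ (\<lambda>x. (q n x)\<^sup>2)" "integral\<^sup>L circ (\<lambda>x. (q n x)\<^sup>2) \<le> ?B" for n
  proof -
    define a where "a j = b j * (sin (real (Suc j) * s n) / s n)" for j
    \<comment> \<open>For a fixed step the multiplier is at most \<open>1 / s n\<close>, which is
      enough for absolute convergence but not uniform in \<open>n\<close>.\<close>
    have a: "summable (\<lambda>j. \<bar>a j\<bar>)"
      by (rule summable_comparison_test[OF _ summable_mult2[OF b, of "1 / s n"]])
         (use s0[of n] in \<open>auto simp: a_def abs_mult intro!: exI[of _ 0] divide_right_mono mult_left_le\<close>)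
    have "b j * cos (real (Suc j) * (x + s n) + c) - b j * cos (real (Suc j) * (x - s n) + c)
        = 2 * s n * (a j * cos (real (Suc j) * x + (c + pi / 2)))" for j x
    proof -
      have "cos (y + z) - cos (y - z) = 2 * sin z * cos (y + pi / 2)" for y z :: real
        by (simp add: cos_add cos_diff)
      from this[of "real (Suc j) * x + c" "real (Suc j) * s n"] s0[of n] show ?thesis
        unfolding right_diff_distrib[symmetric] by (simp add: a_def algebra_simps)
    qed
    then have "H (x + s n) - H (x - s n) = (\<Sum>j. 2 * s n * (a j * cos (real (Suc j) * x + (c + pi / 2))))" for x
      unfolding H by (simp add: suminf_diff[OF smH smH])
    also have "(\<Sum>j. 2 * s n * (a j * cos (real (Suc j) * x + (c + pi / 2))))
        = 2 * s n * (\<Sum>j. a j * cos (real (Suc j) * x + (c + pi / 2)))" for x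
      by (rule suminf_mult, rule summable_comparison_test[OF _ a]) (auto simp: abs_mult intro!: mult_left_le)
    finally have q: "q n = (\<lambda>x. \<Sum>j. a j * cos (real (Suc j) * x + (c + pi / 2)))"
      using s0[of n] by (auto simp: q_def fun_eq_iff)
    show "integrable circ (\<lambda>x. (q n x)\<^sup>2)"
      unfolding q by (intro integrable_circ_continuous continuous_on_power continuous_cos_series a)
    \<comment> \<open>Here the multiplier is bounded by \<open>real (Suc j)\<close> for every step,
      so that the bound \<open>?B\<close> is uniform in \<open>n\<close>.\<close>
    have *: "(a j)\<^sup>2 \<le> (real (Suc j) * b j)\<^sup>2" for j
    proof -
      have "\<bar>sin (real (Suc j) * s n)\<bar> \<le> real (Suc j) * s n"
        using abs_sin_x_le_abs_x[of "real (Suc j) * s n"] s0[of n] by simp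
      then have "\<bar>sin (real (Suc j) * s n) / s n\<bar> \<le> real (Suc j)"
        using s0[of n] by (simp add: field_simps)
      then have "\<bar>a j\<bar> \<le> \<bar>real (Suc j) * b j\<bar>"
        unfolding a_def abs_mult by (subst mult.commute) (intro mult_right_mono, auto)
      then show ?thesis by (simp add: abs_le_square_iff)
    qed
    have "integral\<^sup>L circ (\<lambda>x. (q n x)\<^sup>2) = (\<Sum>j. pi * (a j)\<^sup>2)"
      unfolding q using parseval_cos_series(1)[OF a] by (simp add: sums_iff)
    also have "\<dots> \<le> (\<Sum>j. pi * (real (Suc j) * b j)\<^sup>2)"
      using sums_summable[OF parseval_cos_series(1)[OF a]]
      by (intro suminf_le mult_left_mono * summable_mult b2) auto
    also have "\<dots> = ?B" by (rule suminf_mult[OF b2])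
    finally show "integral\<^sup>L circ (\<lambda>x. (q n x)\<^sup>2) \<le> ?B" .
  qed
  have s_lim: "filterlim s (at 0) sequentially"
    unfolding s_def by (rule filterlim_atI) (use LIMSEQ_inverse_real_of_nat in auto)
  have q_lim: "(\<lambda>n. q n x) \<longlonglongrightarrow> F x" for x
  proof -
    have L: "((\<lambda>h. (H (x + h) - H x) / h) \<longlongrightarrow> F x) (at 0)"
      using F by (simp add: DERIV_def)
    have 1: "(\<lambda>n. (H (x + s n) - H x) / s n) \<longlonglongrightarrow> F x"
      by (rule filterlim_compose[OF L s_lim])
    have "filterlim (\<lambda>n. - s n) (at 0) sequentially"
      using s_lim by (simp add: filterlim_at tendsto_minus_cancel_left[symmetric])
    from filterlim_compose[OF L this]
    have 2: "(\<lambda>n. (H (x + - s n) - H x) / - s n) \<longlonglongrightarrow> F x" .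
    \<comment> \<open>The symmetric quotient is the mean of the right and left quotients, so
      differentiability at the single point \<open>x\<close> yields the limit.\<close>
    have "(\<lambda>n. ((H (x + s n) - H x) / s n + (H (x + - s n) - H x) / - s n) / 2) \<longlonglongrightarrow> (F x + F x) / 2"
      by (intro tendsto_intros 1 2) auto
    moreover have "((H (x + s n) - H x) / s n + (H (x + - s n) - H x) / - s n) / 2 = q n x" for n
      using s0[of n] by (simp add: q_def field_simps)
    ultimately show ?thesis by simp
  qed
  have "ennreal (integral\<^sup>L circ (\<lambda>x. (F x)\<^sup>2)) = (\<integral>\<^sup>+x. ennreal ((F x)\<^sup>2) \<partial>circ)"
    by (rule nn_integral_eq_integral[symmetric]) (use F2 in auto)
  also have "\<dots> = (\<integral>\<^sup>+x. liminf (\<lambda>n. ennreal ((q n x)\<^sup>2)) \<partial>circ)"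
    by (intro nn_integral_cong lim_imp_Liminf[symmetric] tendsto_ennrealI tendsto_intros q_lim) auto
  also have "\<dots> \<le> liminf (\<lambda>n. \<integral>\<^sup>+x. ennreal ((q n x)\<^sup>2) \<partial>circ)"
    unfolding q_def by (intro nn_integral_liminf) measurable
  also have "\<dots> \<le> liminf (\<lambda>n. ennreal ?B)"
    by (intro Liminf_mono always_eventually allI)
       (subst nn_integral_eq_integral, use q_bound in \<open>auto intro!: ennreal_leI\<close>)
  also have "\<dots> = ennreal ?B" by (simp add: Liminf_const)
  finally show ?thesis
    by (subst (asm) ennreal_le_iff) (auto intro!: suminf_nonneg b2 mult_nonneg_nonneg)
qed

section \<open>Fourier coefficients of the kernel\<close>

context
  fixes K :: "real \<Rightarrow> real \<Rightarrow> real" and u :: real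
  assumes kernel: "circular_kernel_family K" and u: "u \<in> {0..<1}"
begin

abbreviation (input) \<alpha> :: "nat \<Rightarrow> real" where "\<alpha> j \<equiv> kernel_coeff K (Suc j) u"

lemma
  shows kernel_measurable: "K u \<in> borel_measurable borel"
    and kernel_periodic: "K u (x + 2 * pi) = K u x"
    and kernel_nonneg: "0 \<le> K u x"
    and kernel_even: "K u (- x) = K u x"
    and integral_kernel: "integral\<^sup>L circ (K u) = 1"
proof -
  have "circular_density (K u)" "\<And>x. K u (- x) = K u x"
    using kernel u unfolding circular_kernel_family_def by blast+
  then show "K u \<in> borel_measurable borel" "K u (x + 2 * pi) = K u x" "0 \<le> K u x"
    "K u (- x) = K u x" "integral\<^sup>L circ (K u) = 1"
    by (simp_all add: circular_density_def LINT_circ periodic_fun_simple_def)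
qed

lemma kernel_coeff_eq: "integral\<^sup>L circ (\<lambda>x. K u x * cos (real j * x)) = kernel_coeff K j u"
  by (simp add: kernel_coeff_def LINT_circ)

lemma kernel_coeff_nonneg: "0 \<le> \<alpha> j"
  using kernel u by (auto simp: circular_kernel_family_def)

text \<open>At the angle 0 every cosine equals 1, so convergence of the Fourier series there is
  convergence of the coefficient sum. With nonnegative coefficients this is absolute, which gives
  continuity of \<open>K u\<close> and termwise integration.\<close>

lemma summable_kernel_coeff: "summable \<alpha>"
proof -
  have "summable (\<lambda>j. \<alpha> j * cos (real (Suc j) * 0))"
    using kernel u unfolding circular_kernel_family_def by blast
  then show ?thesis by simp
qed

lemma summable_abs_kernel_coeff: "summable (\<lambda>j. \<bar>\<alpha> j / pi\<bar>)"
  using summable_divide[OF summable_kernel_coeff, of pi] kernel_coeff_nonneg by simp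

lemma kernel_series: "K u x = 1 / (2 * pi) + (\<Sum>j. \<alpha> j / pi * cos (real (Suc j) * x + 0))"
proof -
  have "summable (\<lambda>j. \<alpha> j * cos (real (Suc j) * x))"
    and eq: "K u x = 1 / (2 * pi) * (1 + 2 * (\<Sum>j. \<alpha> j * cos (real (Suc j) * x)))"
    using kernel u unfolding circular_kernel_family_def by blast+
  from suminf_divide[OF this(1), of pi] show ?thesis
    unfolding eq by (simp add: field_simps)
qed

lemma continuous_kernel: "continuous_on UNIV (K u)"
proof -
  have "K u = (\<lambda>x. 1 / (2 * pi) + (\<Sum>j. \<alpha> j / pi * cos (real (Suc j) * x + 0)))"
    by (rule ext) (rule kernel_series)
  then show ?thesis
    using continuous_cos_series[OF summable_abs_kernel_coeff, of 0]
    by (simp add: continuous_on_add)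
qed

text \<open>The Fourier series is integrated termwise against the square: the constant
  \<open>1 / (2 * pi)\<close> contributes the summand with \<open>pi\<close> squared over 3, and
  \<open>integral_circ_square_cos\<close> supplies the alternating factors.\<close>

lemma h_K_eq: "h_K K u = integral\<^sup>L circ (\<lambda>x. x\<^sup>2 * K u x)"
proof -
  let ?S = "\<lambda>x. \<Sum>j. \<alpha> j / pi * cos (real (Suc j) * x + 0)"
  have sq: "integrable circ (\<lambda>x. x\<^sup>2)"
    by (intro integrable_circ_continuous continuous_intros)
  have "integral\<^sup>L circ (\<lambda>x. x\<^sup>2 * K u x) = integral\<^sup>L circ (\<lambda>x. 1 / (2 * pi) * x\<^sup>2 + ?S x * x\<^sup>2)"
    by (simp only: kernel_series ring_distribs mult.commute)
  also have "\<dots> = 1 / (2 * pi) * integral\<^sup>L circ (\<lambda>x. x\<^sup>2) + integral\<^sup>L circ (\<lambda>x. ?S x * x\<^sup>2)"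
    using integrable_cos_series[OF summable_abs_kernel_coeff sq, of 0] sq
    by (subst Bochner_Integration.integral_add) auto
  also have "1 / (2 * pi) * integral\<^sup>L circ (\<lambda>x. x\<^sup>2) = pi\<^sup>2 / 3"
    unfolding integral_circ_square by (simp add: power2_eq_square power3_eq_cube)
  also have "(\<lambda>j. \<alpha> j / pi * (4 * pi * (-1) ^ Suc j / (real (Suc j))\<^sup>2)) sums integral\<^sup>L circ (\<lambda>x. ?S x * x\<^sup>2)"
    using integral_cos_series[OF summable_abs_kernel_coeff sq, of 0]
    by (simp only: integral_circ_square_cos add_0_right)
  then have "(\<lambda>j. 4 * ((-1) ^ Suc j * \<alpha> j / (real (Suc j))\<^sup>2)) sums integral\<^sup>L circ (\<lambda>x. ?S x * x\<^sup>2)"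
    by (rule sums_cong[THEN iffD1, rotated]) simp
  then have "integral\<^sup>L circ (\<lambda>x. ?S x * x\<^sup>2) = 4 * (\<Sum>j. (-1) ^ Suc j * \<alpha> j / (real (Suc j))\<^sup>2)"
    using sums_mult[of _ _ "1 / 4"] by (fastforce simp: sums_iff)
  finally show ?thesis by (simp add: h_K_def)
qed

section \<open>Derivatives of the kernel up to order \<open>r\<close>\<close>

context
  fixes r :: nat
  assumes diff: "times_differentiable r (K u)"
    and sq: "circular_square_integrable ((deriv ^^ r) (K u))"
begin

lemma kernel_deriv_measurable: "(deriv ^^ r) (K u) \<in> borel_measurable borel"
  using borel_measurable_deriv_funpow[OF diff kernel_measurable] .

lemma kernel_deriv_square_integrable: "integrable circ (\<lambda>x. ((deriv ^^ r) (K u) x)\<^sup>2)"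
  using sq by (simp add: circular_square_integrable_def set_integrable_circ)

text \<open>Below order \<open>r\<close> the derivatives are differentiable, hence continuous; at
  order \<open>r\<close> square-integrability on a finite measure takes over.\<close>

lemma kernel_deriv_integrable:
  assumes "i \<le> r"
  shows "integrable circ ((deriv ^^ i) (K u))"
proof (cases "i < r")
  case True
  then show ?thesis
    by (intro integrable_circ_continuous times_differentiable_continuous[OF diff])
next
  case False
  with assms show ?thesis
    using integrable_circ_of_square[OF measurable_circ[OF kernel_deriv_measurable] kernel_deriv_square_integrable]
    by simp
qed

text \<open>Each integration by parts gains a factor \<open>real (Suc j)\<close>, and the added
  phase \<open>pi / 2\<close> turns the resulting sine back into a cosine. Boundary terms cancel by
  periodicity.\<close>

lemma kernel_deriv_coeff:
  "i \<le> r \<Longrightarrow> integral\<^sup>L circ (\<lambda>x. (deriv ^^ i) (K u) x * cos (real (Suc j) * x + real i * (pi / 2)))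
    = real (Suc j) ^ i * \<alpha> j"
proof (induction i)
  case 0
  then show ?case by (simp add: kernel_coeff_eq)
next
  case (Suc i)
  let ?m = "real (Suc j)" and ?c = "real (Suc i) * (pi / 2)"
  have shift: "sin (?m * x + ?c) = cos (?m * x + real i * (pi / 2))" for x
  proof -
    have "?m * x + ?c = (?m * x + real i * (pi / 2)) + pi / 2" by (simp add: of_nat_Suc field_simps)
    moreover have "sin (y + pi / 2) = cos y" for y :: real by (simp add: sin_add)
    ultimately show ?thesis by (simp only:)
  qed
  have "integral\<^sup>L circ (\<lambda>x. (deriv ^^ Suc i) (K u) x * cos (?m * x + ?c))
      = - integral\<^sup>L circ (\<lambda>x. (deriv ^^ i) (K u) x * (- sin (?m * x + ?c) * ?m))"
  proof (rule integral_circ_by_parts)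
    show "((deriv ^^ i) (K u) has_real_derivative (deriv ^^ Suc i) (K u) x) (at x)" for x
      using times_differentiable_DERIV[OF diff] Suc.prems by simp
    show "((\<lambda>x. cos (?m * x + ?c)) has_real_derivative - sin (?m * x + ?c) * ?m) (at x)" for x
      by (auto intro!: derivative_eq_intros)
    show "integrable circ (\<lambda>x. (deriv ^^ Suc i) (K u) x * cos (?m * x + ?c))"
      by (rule integrable_circ_mult_cos[OF kernel_deriv_integrable[OF Suc.prems]])
    show "integrable circ (\<lambda>x. (deriv ^^ i) (K u) x * (- sin (?m * x + ?c) * ?m))"
      using integrable_circ_mult_cos[OF kernel_deriv_integrable[of i], of ?m "real i * (pi / 2)"] Suc.prems
      unfolding shift by (simp add: mult.assoc[symmetric])
    have "(deriv ^^ i) (K u) pi = (deriv ^^ i) (K u) (- pi)"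
      using periodic_deriv_funpow[of "K u" "2 * pi" i "- pi"] kernel_periodic by simp
    moreover have "cos (?m * pi + ?c) = cos (?m * (- pi) + ?c)"
    proof -
      have "sin (?m * pi) = 0" by (rule sin_npi)
      then show ?thesis by (simp add: cos_add cos_diff)
    qed
    ultimately show "(deriv ^^ i) (K u) pi * cos (?m * pi + ?c) = (deriv ^^ i) (K u) (- pi) * cos (?m * (- pi) + ?c)"
      by simp
  qed
  also have "\<dots> = ?m * integral\<^sup>L circ (\<lambda>x. (deriv ^^ i) (K u) x * cos (?m * x + real i * (pi / 2)))"
    unfolding shift by (simp add: mult.assoc[symmetric] del: mult_minus_left)
  finally show ?case using Suc by simp
qed

lemma kernel_deriv_bessel:
  shows "summable (\<lambda>j. (real (Suc j) ^ r * \<alpha> j)\<^sup>2)"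
    and "(\<Sum>j. (real (Suc j) ^ r * \<alpha> j)\<^sup>2) \<le> pi * integral\<^sup>L circ (\<lambda>x. ((deriv ^^ r) (K u) x)\<^sup>2)"
  using bessel_cos[OF measurable_circ[OF kernel_deriv_measurable] kernel_deriv_square_integrable
      kernel_deriv_coeff[OF order_refl]] by blast+

text \<open>Square summability at order \<open>r\<close> gives absolute summability one order lower:
  split off the factor \<open>1 / real (Suc j)\<close> and bound the product by the sum of the two
  squares.\<close>

lemma summable_kernel_deriv_coeff:
  assumes "i < r"
  shows "summable (\<lambda>j. real (Suc j) ^ i * \<alpha> j)"
proof (rule summable_comparison_test)
  show "summable (\<lambda>j. (real (Suc j) ^ r * \<alpha> j)\<^sup>2 + 1 / (real (Suc j))\<^sup>2)"
    using inverse_power_summable[of 2, where ?'a = real] summable_Suc_iff[of "\<lambda>j. inverse ((real j)\<^sup>2)"]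
    by (intro summable_add kernel_deriv_bessel(1)) (simp add: divide_inverse)
  have "real (Suc j) ^ i * \<alpha> j \<le> (real (Suc j) ^ r * \<alpha> j)\<^sup>2 + 1 / (real (Suc j))\<^sup>2" for j
  proof -
    let ?m = "real (Suc j)"
    have pos: "?m > 0" by simp
    have "?m ^ i \<le> ?m ^ (r - 1)" using assms by (intro power_increasing) (auto simp: of_nat_Suc)
    also have "\<dots> = ?m ^ r / ?m" using assms pos by (cases r) auto
    finally have "?m ^ i * \<alpha> j \<le> (?m ^ r * \<alpha> j) * (1 / ?m)"
      using mult_right_mono[OF _ kernel_coeff_nonneg[of j], of "?m ^ i" "?m ^ r / ?m"] by simp
    also have "\<dots> \<le> (?m ^ r * \<alpha> j)\<^sup>2 + (1 / ?m)\<^sup>2"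
    proof -
      have "0 \<le> (?m ^ r * \<alpha> j) * (1 / ?m)" using kernel_coeff_nonneg[of j] by simp
      then show ?thesis using sum_squares_bound[of "?m ^ r * \<alpha> j" "1 / ?m"] by linarith
    qed
    finally show ?thesis by (simp add: power_divide)
  qed
  then show "\<exists>N. \<forall>j\<ge>N. norm (real (Suc j) ^ i * \<alpha> j) \<le> (real (Suc j) ^ r * \<alpha> j)\<^sup>2 + 1 / (real (Suc j))\<^sup>2"
    using kernel_coeff_nonneg by (simp add: abs_mult)
qed

text \<open>Differentiating termwise up to order \<open>i\<close> uses absolute summability at order
  \<open>i\<close>, which is available for \<open>i < r\<close>. The constant term disappears with
  the first derivative.\<close>

lemma kernel_deriv_series:
  "i < r \<Longrightarrow> (deriv ^^ i) (K u) x = (if i = 0 then 1 / (2 * pi) else 0)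
    + (\<Sum>j. real (Suc j) ^ i * \<alpha> j / pi * cos (real (Suc j) * x + real i * (pi / 2)))"
proof (induction i arbitrary: x)
  case 0
  then show ?case using kernel_series by simp
next
  case (Suc i)
  let ?d = "if i = 0 then 1 / (2 * pi) else 0"
  let ?a = "\<lambda>j. real (Suc j) ^ i * \<alpha> j / pi"
  have eq: "(deriv ^^ i) (K u) = (\<lambda>x. ?d + (\<Sum>j. ?a j * cos (real (Suc j) * x + real i * (pi / 2))))"
    by (rule ext) (use Suc in simp)
  have "summable (\<lambda>j. real (Suc j) * \<bar>?a j\<bar>)"
    using summable_divide[OF summable_kernel_deriv_coeff[OF Suc.prems], of pi] kernel_coeff_nonneg
    by (simp add: abs_mult mult.assoc)
  from DERIV_cos_series[OF this, of "real i * (pi / 2)" x]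
  have "((deriv ^^ i) (K u) has_real_derivative
    (\<Sum>j. (real (Suc j) * ?a j) * cos (real (Suc j) * x + (real i * (pi / 2) + pi / 2)))) (at x)"
    unfolding eq by (auto intro!: derivative_eq_intros)
  from DERIV_imp_deriv[OF this] show ?case
    by (simp add: mult.assoc of_nat_Suc[of i] algebra_simps add_divide_distrib)
qed

text \<open>For \<open>r = 0\<close> Parseval applies directly, and the constant Fourier term
  accounts for the separate form of \<open>R_K\<close>. For \<open>r > 0\<close> the bound
  \<open>integral_square_deriv_le\<close>, applied to the derivative of order \<open>r - 1\<close>,
  meets the opposite bound from Bessel.\<close>

lemma R_K_eq: "R_K K r u = integral\<^sup>L circ (\<lambda>x. ((deriv ^^ r) (K u) x)\<^sup>2)"
proof (cases r)
  case 0
  let ?S = "\<lambda>x. \<Sum>j. \<alpha> j / pi * cos (real (Suc j) * x + 0)"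
  note S = continuous_cos_series[OF summable_abs_kernel_coeff, of 0]
  have iS: "integrable circ ?S" "integrable circ (\<lambda>x. (?S x)\<^sup>2)"
    by (intro integrable_circ_continuous continuous_on_power S)+
  have "integral\<^sup>L circ (\<lambda>x. (K u x)\<^sup>2)
      = integral\<^sup>L circ (\<lambda>x. (1 / (2 * pi))\<^sup>2 + 1 / pi * ?S x + (?S x)\<^sup>2)"
  proof -
    have "(1 / (2 * pi) + y)\<^sup>2 = (1 / (2 * pi))\<^sup>2 + 1 / pi * y + y\<^sup>2" for y
      by (simp add: power2_eq_square field_simps)
    then show ?thesis by (simp only: kernel_series)
  qed
  also have "\<dots> = integral\<^sup>L circ (\<lambda>x. (1 / (2 * pi))\<^sup>2) + 1 / pi * integral\<^sup>L circ ?S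
      + integral\<^sup>L circ (\<lambda>x. (?S x)\<^sup>2)"
    using iS by (simp del: integral_mult_right_zero integral_divide_zero flip: integral_mult_right_zero)
  also have "integral\<^sup>L circ (\<lambda>x. (1 / (2 * pi))\<^sup>2) = 1 / (2 * pi)"
    by (simp only: integral_circ_const) (simp add: power2_eq_square)
  also have "integral\<^sup>L circ ?S = 0" by (rule parseval_cos_series(2)[OF summable_abs_kernel_coeff])
  also have "integral\<^sup>L circ (\<lambda>x. (?S x)\<^sup>2) = (\<Sum>j. 1 / pi * (\<alpha> j)\<^sup>2)"
    using parseval_cos_series(1)[OF summable_abs_kernel_coeff, of 0]
    by (simp add: sums_iff power_divide power2_eq_square)
  also have "\<dots> = 1 / pi * (\<Sum>j. (\<alpha> j)\<^sup>2)"
    using kernel_deriv_bessel(1) 0 by (intro suminf_mult) simp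
  finally show ?thesis using 0 by (simp add: R_K_def algebra_simps)
next
  case (Suc k)
  let ?b = "\<lambda>j. real (Suc j) ^ k * \<alpha> j / pi"
  let ?I = "integral\<^sup>L circ (\<lambda>x. ((deriv ^^ r) (K u) x)\<^sup>2)"
  have sq_b: "(real (Suc j) * ?b j)\<^sup>2 = (real (Suc j) ^ r * \<alpha> j)\<^sup>2 / pi\<^sup>2" for j
    by (simp add: Suc power_divide mult.assoc)
  have "?I \<le> pi * (\<Sum>j. (real (Suc j) * ?b j)\<^sup>2)"
  proof (rule integral_square_deriv_le)
    show "(deriv ^^ k) (K u) x = (if k = 0 then 1 / (2 * pi) else 0)
        + (\<Sum>j. ?b j * cos (real (Suc j) * x + real k * (pi / 2)))" for x
      using Suc by (intro kernel_deriv_series) simp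
    show "summable (\<lambda>j. \<bar>?b j\<bar>)"
      using summable_divide[OF summable_kernel_deriv_coeff[of k], of pi] kernel_coeff_nonneg Suc
      by (simp add: abs_mult)
    show "summable (\<lambda>j. (real (Suc j) * ?b j)\<^sup>2)"
      unfolding sq_b by (intro summable_divide kernel_deriv_bessel(1))
    show "((deriv ^^ k) (K u) has_real_derivative (deriv ^^ r) (K u) x) (at x)" for x
      using times_differentiable_DERIV[OF diff, of k] Suc by simp
  qed (rule kernel_deriv_square_integrable)
  also have "\<dots> = (\<Sum>j. (real (Suc j) ^ r * \<alpha> j)\<^sup>2) / pi"
    unfolding sq_b suminf_divide[OF kernel_deriv_bessel(1)] by (simp add: power2_eq_square)
  finally have "?I = (\<Sum>j. (real (Suc j) ^ r * \<alpha> j)\<^sup>2) / pi"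
    using kernel_deriv_bessel(2) by (simp add: field_simps)
  moreover have "(m ^ r * a)\<^sup>2 = m ^ (2 * r) * a\<^sup>2" for m a :: real
    by (simp add: power_mult_distrib mult.commute[of 2] flip: power_mult)
  moreover have "r \<noteq> 0" using Suc by simp
  ultimately show ?thesis by (simp add: R_K_def)
qed

end

end

section \<open>Bias\<close>

text \<open>One integer \<open>k\<close> serves all \<open>y\<close>, so two nearby points can be
  moved by the same number of periods, as uniform continuity requires.\<close>

lemma periodic_reduce:
  fixes g :: "real \<Rightarrow> real"
  assumes "\<And>x. g (x + 2 * pi) = g x"
  obtains k where "x - of_int k * (2 * pi) \<in> {-pi..<pi}" "\<And>y. g (y - of_int k * (2 * pi)) = g y"
proof
  define k where "k = \<lfloor>(x + pi) / (2 * pi)\<rfloor>"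
  have "of_int k \<le> (x + pi) / (2 * pi)" "(x + pi) / (2 * pi) < of_int k + 1"
    unfolding k_def by linarith+
  then show "x - of_int k * (2 * pi) \<in> {-pi..<pi}" by (auto simp: field_simps)
  interpret periodic_fun_simple g "2 * pi" by standard (rule assms)
  show "g (y - of_int k * (2 * pi)) = g y" for y by (rule minus_of_int)
qed

lemma periodic_continuous_bounded:
  fixes g :: "real \<Rightarrow> real"
  assumes "continuous_on UNIV g" "\<And>x. g (x + 2 * pi) = g x"
  obtains B where "\<And>x. \<bar>g x\<bar> \<le> B"
proof -
  have "compact (g ` {-pi..pi})"
    using assms by (intro compact_continuous_image) (auto intro: continuous_on_subset)
  then obtain B where B: "\<And>x. x \<in> {-pi..pi} \<Longrightarrow> \<bar>g x\<bar> \<le> B"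
    by (metis bounded_iff compact_imp_bounded image_eqI real_norm_def)
  have "\<bar>g x\<bar> \<le> B" for x
  proof -
    obtain k where "x - of_int k * (2 * pi) \<in> {-pi..<pi}" "g (x - of_int k * (2 * pi)) = g x"
      using periodic_reduce[of g x] assms(2) by metis
    then show ?thesis using B[of "x - of_int k * (2 * pi)"] by simp
  qed
  then show ?thesis by (rule that)
qed

lemma periodic_uniformly_continuous:
  fixes g :: "real \<Rightarrow> real"
  assumes "continuous_on UNIV g" "\<And>x. g (x + 2 * pi) = g x" "e > 0"
  obtains d where "d > 0" "\<And>x y. \<bar>y - x\<bar> < d \<Longrightarrow> \<bar>g y - g x\<bar> \<le> e"
proof -
  \<comment> \<open>The margin 1 keeps the partner of a point of [-pi, pi) inside the compact
    interval when their distance is below \<open>min d 1\<close>.\<close>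
  have "uniformly_continuous_on {-pi - 1..pi + 1} g"
    using assms by (intro compact_uniformly_continuous) (auto intro: continuous_on_subset)
  then obtain d where d: "d > 0"
      "\<And>x y. x \<in> {-pi - 1..pi + 1} \<Longrightarrow> y \<in> {-pi - 1..pi + 1} \<Longrightarrow> \<bar>y - x\<bar> < d \<Longrightarrow> \<bar>g y - g x\<bar> < e"
    using \<open>e > 0\<close> unfolding uniformly_continuous_on_def dist_real_def by metis
  have "\<bar>g y - g x\<bar> \<le> e" if "\<bar>y - x\<bar> < min d 1" for x y
  proof -
    obtain k where k: "x - of_int k * (2 * pi) \<in> {-pi..<pi}" "\<And>y. g (y - of_int k * (2 * pi)) = g y"
      using periodic_reduce[of g x] assms(2) by metis
    have "\<bar>g (y - of_int k * (2 * pi)) - g (x - of_int k * (2 * pi))\<bar> < e"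
      using k(1) that by (intro d(2)) (auto simp: abs_less_iff)
    then show ?thesis by (simp add: k(2))
  qed
  then show ?thesis using that[of "min d 1"] d(1) by simp
qed

lemma taylor_second_order:
  fixes g g1 g2 :: "real \<Rightarrow> real"
  assumes "\<And>x. (g has_real_derivative g1 x) (at x)" "\<And>x. (g1 has_real_derivative g2 x) (at x)"
  obtains \<xi> where "\<bar>\<xi> - \<theta>\<bar> \<le> \<bar>t\<bar>" "g (\<theta> - t) = g \<theta> - t * g1 \<theta> + t\<^sup>2 / 2 * g2 \<xi>"
proof (cases "t = 0")
  case False
  define diff where "diff n = (if n = 0 then g else if n = 1 then g1 else g2)" for n :: nat
  have "\<exists>\<xi>. (if \<theta> - t < \<theta> then \<theta> - t < \<xi> \<and> \<xi> < \<theta> else \<theta> < \<xi> \<and> \<xi> < \<theta> - t) \<and>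
    g (\<theta> - t) = (\<Sum>m<2. diff m \<theta> / fact m * (\<theta> - t - \<theta>) ^ m) + diff 2 \<xi> / fact 2 * (\<theta> - t - \<theta>) ^ 2"
    using False assms
    by (intro Taylor[where a = "\<theta> - \<bar>t\<bar>" and b = "\<theta> + \<bar>t\<bar>"]) (auto simp: diff_def less_Suc_eq numeral_2_eq_2)
  then obtain \<xi> where "if \<theta> - t < \<theta> then \<theta> - t < \<xi> \<and> \<xi> < \<theta> else \<theta> < \<xi> \<and> \<xi> < \<theta> - t"
    "g (\<theta> - t) = (\<Sum>m<2. diff m \<theta> / fact m * (\<theta> - t - \<theta>) ^ m) + diff 2 \<xi> / fact 2 * (\<theta> - t - \<theta>) ^ 2"
    by blast
  then show ?thesis
    by (intro that[of \<xi>]) (auto simp: diff_def numeral_2_eq_2 algebra_simps split: if_splits)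
qed (use that in auto)

lemma convolution_measurable:
  fixes k g :: "real \<Rightarrow> real"
  assumes "k \<in> borel_measurable borel" "g \<in> borel_measurable borel"
  shows "(\<lambda>\<theta>. integral\<^sup>L circ (\<lambda>t. k t * g (\<theta> - t))) \<in> borel_measurable borel"
proof (rule circ.borel_measurable_lebesgue_integral)
  have id: "(\<lambda>t. t) \<in> measurable circ borel" by (rule measurable_circ) simp
  have [measurable]: "snd \<in> measurable (borel \<Otimes>\<^sub>M circ) borel"
    by (rule measurable_compose[OF measurable_snd id])
  note assms[measurable]
  show "(\<lambda>(\<theta>, t). k t * g (\<theta> - t)) \<in> borel_measurable (borel \<Otimes>\<^sub>M circ)"
    unfolding case_prod_beta by measurable
qed

text \<open>The bias of a kernel \<open>k\<close> with second moment \<open>h\<close>; the odd Taylor term drops out by symmetry.\<close>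
context
  fixes k g g1 g2 :: "real \<Rightarrow> real" and B h :: real
  assumes k: "continuous_on UNIV k" "\<And>x. 0 \<le> k x" "\<And>x. k (- x) = k x" "integral\<^sup>L circ k = 1"
    and h: "h = integral\<^sup>L circ (\<lambda>x. x\<^sup>2 * k x)"
    and g1: "\<And>x. (g has_real_derivative g1 x) (at x)"
    and g2: "\<And>x. (g1 has_real_derivative g2 x) (at x)"
    and B: "\<And>x. \<bar>g2 x\<bar> \<le> B"
begin

lemma kernel_odd_moment: "integral\<^sup>L circ (\<lambda>x. x * k x) = 0"
proof -
  have "integral\<^sup>L circ (\<lambda>x. (- x) * k (- x)) = integral\<^sup>L circ (\<lambda>x. x * k x)"
    by (rule integral_circ_reflect[of "\<lambda>x. x * k x"])
       (auto intro!: borel_measurable_continuous_onI continuous_intros k)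
  then show ?thesis by (simp add: k)
qed

lemma continuous_g: "continuous_on UNIV g" "continuous_on UNIV (\<lambda>t. g (\<theta> - t))"
proof -
  show *: "continuous_on UNIV g"
    by (intro continuous_at_imp_continuous_on ballI DERIV_isCont[OF g1])
  show "continuous_on UNIV (\<lambda>t. g (\<theta> - t))"
    by (rule continuous_on_compose2[OF *]) (auto intro!: continuous_intros)
qed

text \<open>Subtracting \<open>g \<theta>\<close> and adding \<open>t * g1 \<theta>\<close> under
  the integral is exact because \<open>k\<close> has mass 1 and vanishing first moment. The free
  \<open>c\<close> is 0 for the crude bound and \<open>g2 \<theta>\<close> for the
  expansion.\<close>

lemma bias_eq:
  "integral\<^sup>L circ (\<lambda>t. k t * g (\<theta> - t)) - g \<theta> - c * h / 2
    = integral\<^sup>L circ (\<lambda>t. k t * (g (\<theta> - t) - g \<theta> + t * g1 \<theta> - t\<^sup>2 / 2 * c))"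
proof -
  have int: "integrable circ (\<lambda>t. k t * g (\<theta> - t))" "integrable circ k"
    "integrable circ (\<lambda>t. t * k t)" "integrable circ (\<lambda>t. t\<^sup>2 * k t)"
    by (intro integrable_circ_continuous continuous_intros k continuous_g)+
  have "integral\<^sup>L circ (\<lambda>t. k t * (g (\<theta> - t) - g \<theta> + t * g1 \<theta> - t\<^sup>2 / 2 * c))
    = integral\<^sup>L circ (\<lambda>t. k t * g (\<theta> - t) - k t * g \<theta> + t * k t * g1 \<theta> - t\<^sup>2 * k t * (c / 2))"
    by (intro Bochner_Integration.integral_cong refl) (simp add: algebra_simps)
  also have "\<dots> = integral\<^sup>L circ (\<lambda>t. k t * g (\<theta> - t)) - 1 * g \<theta> + 0 * g1 \<theta> - h * (c / 2)"
    using int by (simp del: integral_divide_zero add: k h kernel_odd_moment)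
  finally show ?thesis by simp
qed

lemma bias_bound: "\<bar>integral\<^sup>L circ (\<lambda>t. k t * g (\<theta> - t)) - g \<theta>\<bar> \<le> h * B / 2"
proof -
  have "\<bar>integral\<^sup>L circ (\<lambda>t. k t * g (\<theta> - t)) - g \<theta>\<bar>
      = norm (integral\<^sup>L circ (\<lambda>t. k t * (g (\<theta> - t) - g \<theta> + t * g1 \<theta> - t\<^sup>2 / 2 * 0)))"
    using bias_eq[of \<theta> 0] by simp
  also have "\<dots> \<le> integral\<^sup>L circ (\<lambda>t. t\<^sup>2 * k t * (B / 2))"
  proof (rule order.trans[OF Bochner_Integration.integral_norm_bound integral_mono])
    show "integrable circ (\<lambda>t. norm (k t * (g (\<theta> - t) - g \<theta> + t * g1 \<theta> - t\<^sup>2 / 2 * 0)))"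
      "integrable circ (\<lambda>t. t\<^sup>2 * k t * (B / 2))"
      by (auto intro!: integrable_circ_continuous continuous_intros k(1) continuous_g)
    show "norm (k t * (g (\<theta> - t) - g \<theta> + t * g1 \<theta> - t\<^sup>2 / 2 * 0)) \<le> t\<^sup>2 * k t * (B / 2)" for t
    proof -
      obtain \<xi> where "g (\<theta> - t) = g \<theta> - t * g1 \<theta> + t\<^sup>2 / 2 * g2 \<xi>"
        using taylor_second_order[OF g1 g2] by metis
      then have "norm (k t * (g (\<theta> - t) - g \<theta> + t * g1 \<theta> - t\<^sup>2 / 2 * 0)) = (t\<^sup>2 * k t) * (\<bar>g2 \<xi>\<bar> / 2)"
        using k(2)[of t] by (simp add: abs_mult)
      also have "\<dots> \<le> (t\<^sup>2 * k t) * (B / 2)"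
        using k(2)[of t] B[of \<xi>] by (intro mult_left_mono) auto
      finally show ?thesis .
    qed
  qed
  also have "\<dots> = h * B / 2" by (simp add: h)
  finally show ?thesis .
qed

lemma bias_expansion:
  assumes d: "d > 0" "\<And>x y. \<bar>y - x\<bar> < d \<Longrightarrow> \<bar>g2 y - g2 x\<bar> \<le> e"
  shows "\<bar>integral\<^sup>L circ (\<lambda>t. k t * g (\<theta> - t)) - g \<theta> - g2 \<theta> * h / 2\<bar>
    \<le> h * e / 2 + integral\<^sup>L circ (\<lambda>t. t ^ 4 * k t) * (B / d\<^sup>2)"
proof -
  have "\<bar>integral\<^sup>L circ (\<lambda>t. k t * g (\<theta> - t)) - g \<theta> - g2 \<theta> * h / 2\<bar>
      = norm (integral\<^sup>L circ (\<lambda>t. k t * (g (\<theta> - t) - g \<theta> + t * g1 \<theta> - t\<^sup>2 / 2 * g2 \<theta>)))"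
    using bias_eq[of \<theta> "g2 \<theta>"] by simp
  also have "\<dots> \<le> integral\<^sup>L circ (\<lambda>t. t\<^sup>2 * k t * (e / 2) + t ^ 4 * k t * (B / d\<^sup>2))"
  proof (rule order.trans[OF Bochner_Integration.integral_norm_bound integral_mono])
    show "integrable circ (\<lambda>t. norm (k t * (g (\<theta> - t) - g \<theta> + t * g1 \<theta> - t\<^sup>2 / 2 * g2 \<theta>)))"
      "integrable circ (\<lambda>t. t\<^sup>2 * k t * (e / 2) + t ^ 4 * k t * (B / d\<^sup>2))"
      using d(1) by (auto intro!: integrable_circ_continuous continuous_intros k(1) continuous_g)
    show "norm (k t * (g (\<theta> - t) - g \<theta> + t * g1 \<theta> - t\<^sup>2 / 2 * g2 \<theta>))
        \<le> t\<^sup>2 * k t * (e / 2) + t ^ 4 * k t * (B / d\<^sup>2)" for t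
    proof -
      obtain \<xi> where \<xi>: "\<bar>\<xi> - \<theta>\<bar> \<le> \<bar>t\<bar>" "g (\<theta> - t) = g \<theta> - t * g1 \<theta> + t\<^sup>2 / 2 * g2 \<xi>"
        using taylor_second_order[OF g1 g2] by metis
      have e0: "0 \<le> e" using d(2)[of 0 0] d(1) by simp
      have B0: "0 \<le> B" using B[of 0] by linarith
      \<comment> \<open>Far from 0 the trivial bound \<open>2 * B\<close> is multiplied by
        \<open>t^2 / d^2\<close>, which is at least 1 there. Against the Taylor weight
        \<open>t^2 * k t / 2\<close> this becomes the fourth moment with constant
        \<open>B / d^2\<close>.\<close>
      have "\<bar>g2 \<xi> - g2 \<theta>\<bar> \<le> e + 2 * B * (t\<^sup>2 / d\<^sup>2)"
      proof (cases "\<bar>t\<bar> < d")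
        case True
        then show ?thesis
          using d(2)[of \<xi> \<theta>] \<xi>(1) B0 by (smt (verit) divide_nonneg_nonneg mult_nonneg_nonneg zero_le_power2)
      next
        case False
        then have "d\<^sup>2 \<le> t\<^sup>2" using d(1) by (simp add: abs_le_square_iff[symmetric])
        then have "1 \<le> t\<^sup>2 / d\<^sup>2" using d(1) by simp
        then have "2 * B * 1 \<le> 2 * B * (t\<^sup>2 / d\<^sup>2)" using B0 by (intro mult_left_mono) auto
        then show ?thesis using B[of \<xi>] B[of \<theta>] e0 by linarith
      qed
      then have "(t\<^sup>2 * k t / 2) * \<bar>g2 \<xi> - g2 \<theta>\<bar> \<le> (t\<^sup>2 * k t / 2) * (e + 2 * B * (t\<^sup>2 / d\<^sup>2))"
        using k(2)[of t] by (intro mult_left_mono) auto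
      moreover have "k t * (g (\<theta> - t) - g \<theta> + t * g1 \<theta> - t\<^sup>2 / 2 * g2 \<theta>) = (t\<^sup>2 * k t / 2) * (g2 \<xi> - g2 \<theta>)"
        by (simp add: \<xi>(2) algebra_simps)
      moreover have "\<bar>(t\<^sup>2 * k t / 2) * (g2 \<xi> - g2 \<theta>)\<bar> = (t\<^sup>2 * k t / 2) * \<bar>g2 \<xi> - g2 \<theta>\<bar>"
        using k(2)[of t] by (simp add: abs_mult)
      moreover have "(t\<^sup>2 * k t / 2) * (e + 2 * B * (t\<^sup>2 / d\<^sup>2)) = t\<^sup>2 * k t * (e / 2) + t ^ 4 * k t * (B / d\<^sup>2)"
        by (simp add: algebra_simps power4_eq_xxxx power2_eq_square add_divide_distrib)
      ultimately show ?thesis by (simp only: real_norm_def)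
    qed
  qed
  also have "\<dots> = h * e / 2 + integral\<^sup>L circ (\<lambda>t. t ^ 4 * k t) * (B / d\<^sup>2)"
  proof -
    have "integrable circ (\<lambda>t. t\<^sup>2 * k t)" "integrable circ (\<lambda>t. t ^ 4 * k t)"
      by (intro integrable_circ_continuous continuous_intros k)+
    then show ?thesis by (simp add: h)
  qed
  finally show ?thesis .
qed

abbreviation (input) bias :: "real \<Rightarrow> real" where
  "bias \<theta> \<equiv> integral\<^sup>L circ (\<lambda>t. k t * g (\<theta> - t)) - g \<theta>"

lemma bias_measurable: "bias \<in> borel_measurable borel"
  using continuous_g(1) k(1)
  by (intro borel_measurable_diff convolution_measurable borel_measurable_continuous_onI)

lemma second_moment_nonneg: "0 \<le> h"
  unfolding h using k(2) by simp

lemma integrable_bias_square: "integrable circ (\<lambda>\<theta>. (bias \<theta>)\<^sup>2)"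
  and integral_bias_square_le: "integral\<^sup>L circ (\<lambda>\<theta>. (bias \<theta>)\<^sup>2) \<le> 2 * pi * (h * B / 2)\<^sup>2"
proof -
  have bd: "(bias \<theta>)\<^sup>2 \<le> (h * B / 2)\<^sup>2" for \<theta>
    using bias_bound[of \<theta>] by (simp add: abs_le_square_iff[symmetric])
  show i: "integrable circ (\<lambda>\<theta>. (bias \<theta>)\<^sup>2)"
    using bias_measurable bd by (intro integrable_circ_bounded[where B = "(h * B / 2)\<^sup>2"]) auto
  have "integral\<^sup>L circ (\<lambda>\<theta>. (bias \<theta>)\<^sup>2) \<le> integral\<^sup>L circ (\<lambda>\<theta>. (h * B / 2)\<^sup>2)"
    by (intro integral_mono i bd) simp
  then show "integral\<^sup>L circ (\<lambda>\<theta>. (bias \<theta>)\<^sup>2) \<le> 2 * pi * (h * B / 2)\<^sup>2"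
    by (simp only: integral_circ_const)
qed

text \<open>The difference of squares factors into the expansion error and a sum of size at most
  \<open>h * B\<close>; an error of smaller order than \<open>h\<close> thus becomes one of smaller
  order than \<open>h^2\<close>. The factor \<open>2 * pi\<close> is the length of the
  circle.\<close>

lemma integral_bias_square_expansion:
  assumes d: "d > 0" "\<And>x y. \<bar>y - x\<bar> < d \<Longrightarrow> \<bar>g2 y - g2 x\<bar> \<le> e"
  shows "\<bar>integral\<^sup>L circ (\<lambda>\<theta>. (bias \<theta>)\<^sup>2) - 1 / 4 * h\<^sup>2 * integral\<^sup>L circ (\<lambda>\<theta>. (g2 \<theta>)\<^sup>2)\<bar>
    \<le> 2 * pi * ((h * e / 2 + integral\<^sup>L circ (\<lambda>t. t ^ 4 * k t) * (B / d\<^sup>2)) * (h * B))"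
proof -
  let ?D = "h * e / 2 + integral\<^sup>L circ (\<lambda>t. t ^ 4 * k t) * (B / d\<^sup>2)"
  have [measurable]: "g2 \<in> borel_measurable borel" by (rule borel_measurable_DERIV[OF g2])
  have g2_sq: "integrable circ (\<lambda>\<theta>. (g2 \<theta> * h / 2)\<^sup>2)"
  proof (rule integrable_circ_bounded)
    show "\<bar>(g2 x * h / 2)\<^sup>2\<bar> \<le> (B * h / 2)\<^sup>2" for x
      using B[of x] second_moment_nonneg by (simp add: abs_mult abs_le_square_iff[symmetric] mult_mono)
  qed measurable
  have bd: "norm ((bias \<theta>)\<^sup>2 - (g2 \<theta> * h / 2)\<^sup>2) \<le> ?D * (h * B)" for \<theta>
  proof -
    have "\<bar>g2 \<theta> * h / 2\<bar> \<le> h * B / 2"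
      using mult_right_mono[OF B[of \<theta>] second_moment_nonneg] second_moment_nonneg
      by (simp add: abs_mult mult.commute)
    then have sum: "\<bar>bias \<theta> + g2 \<theta> * h / 2\<bar> \<le> h * B"
      using bias_bound[of \<theta>] by linarith
    have "norm ((bias \<theta>)\<^sup>2 - (g2 \<theta> * h / 2)\<^sup>2)
        = \<bar>bias \<theta> - g2 \<theta> * h / 2\<bar> * \<bar>bias \<theta> + g2 \<theta> * h / 2\<bar>"
      unfolding real_norm_def abs_mult[symmetric] by (simp only: power2_eq_square square_diff_square_factored mult.commute)
    also have "\<dots> \<le> ?D * (h * B)"
      using bias_expansion[OF d, of \<theta>] sum by (intro mult_mono) auto
    finally show ?thesis .
  qed
  have "integral\<^sup>L circ (\<lambda>\<theta>. (bias \<theta>)\<^sup>2) - 1 / 4 * h\<^sup>2 * integral\<^sup>L circ (\<lambda>\<theta>. (g2 \<theta>)\<^sup>2)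
      = integral\<^sup>L circ (\<lambda>\<theta>. (bias \<theta>)\<^sup>2) - integral\<^sup>L circ (\<lambda>\<theta>. (g2 \<theta> * h / 2)\<^sup>2)"
    by (simp add: power_mult_distrib power_divide)
  also have "\<dots> = integral\<^sup>L circ (\<lambda>\<theta>. (bias \<theta>)\<^sup>2 - (g2 \<theta> * h / 2)\<^sup>2)"
    using integrable_bias_square g2_sq by simp
  finally have "\<bar>integral\<^sup>L circ (\<lambda>\<theta>. (bias \<theta>)\<^sup>2) - 1 / 4 * h\<^sup>2 * integral\<^sup>L circ (\<lambda>\<theta>. (g2 \<theta>)\<^sup>2)\<bar>
      \<le> integral\<^sup>L circ (\<lambda>\<theta>. norm ((bias \<theta>)\<^sup>2 - (g2 \<theta> * h / 2)\<^sup>2))"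
    using Bochner_Integration.integral_norm_bound[of circ "\<lambda>\<theta>. (bias \<theta>)\<^sup>2 - (g2 \<theta> * h / 2)\<^sup>2"] by simp
  also have "\<dots> \<le> integral\<^sup>L circ (\<lambda>\<theta>. ?D * (h * B))"
    using integrable_bias_square g2_sq by (intro integral_mono bd) auto
  finally show ?thesis by (simp only: integral_circ_const)
qed

end

section \<open>Mean integrated squared error\<close>

lemma (in prob_space) mse_sample_mean:
  fixes X :: "nat \<Rightarrow> 'a \<Rightarrow> real"
  assumes "n \<ge> 1" and indep: "indep_vars (\<lambda>_. borel) X {1..n}"
    and X: "\<And>i. i \<in> {1..n} \<Longrightarrow> integrable M (X i)"
    and X2: "\<And>i. i \<in> {1..n} \<Longrightarrow> integrable M (\<lambda>\<omega>. (X i \<omega>)\<^sup>2)"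
    and m: "\<And>i. i \<in> {1..n} \<Longrightarrow> expectation (X i) = m"
    and q: "\<And>i. i \<in> {1..n} \<Longrightarrow> expectation (\<lambda>\<omega>. (X i \<omega>)\<^sup>2) = q"
  shows "expectation (\<lambda>\<omega>. (1 / real n * (\<Sum>i=1..n. X i \<omega>) - c)\<^sup>2) = (m - c)\<^sup>2 + (q - m\<^sup>2) / real n"
proof -
  have XX: "integrable M (\<lambda>\<omega>. X i \<omega> * X j \<omega>)"
      "expectation (\<lambda>\<omega>. X i \<omega> * X j \<omega>) = m\<^sup>2 + (if i = j then q - m\<^sup>2 else 0)"
    if "i \<in> {1..n}" "j \<in> {1..n}" for i j
  proof -
    \<comment> \<open>The product over the set \<open>{i, j}\<close> collapses to \<open>X i\<close>
      when \<open>i = j\<close>; independence then matters off the diagonal, and the diagonal is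
      settled by the second moment.\<close>
    have *: "integrable M (\<lambda>\<omega>. \<Prod>k\<in>{i, j}. X k \<omega>)"
        "expectation (\<lambda>\<omega>. \<Prod>k\<in>{i, j}. X k \<omega>) = (\<Prod>k\<in>{i, j}. expectation (X k))"
      using that X by (intro indep_vars_integrable indep_vars_lebesgue_integral
        indep_vars_subset[OF indep]; auto)+
    show "integrable M (\<lambda>\<omega>. X i \<omega> * X j \<omega>)"
      "expectation (\<lambda>\<omega>. X i \<omega> * X j \<omega>) = m\<^sup>2 + (if i = j then q - m\<^sup>2 else 0)"
      using * X2[OF that(1)] q[OF that(1)] m[OF that(1)] m[OF that(2)]
      by (cases "i = j"; simp add: power2_eq_square)+
  qed
  have S: "integrable M (\<lambda>\<omega>. \<Sum>i=1..n. X i \<omega>)" "expectation (\<lambda>\<omega>. \<Sum>i=1..n. X i \<omega>) = real n * m"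
    using X m by (auto simp: Bochner_Integration.integral_sum)
  have SS: "integrable M (\<lambda>\<omega>. \<Sum>i=1..n. \<Sum>j=1..n. X i \<omega> * X j \<omega>)"
    using XX by (intro Bochner_Integration.integrable_sum) auto
  have "expectation (\<lambda>\<omega>. \<Sum>i=1..n. \<Sum>j=1..n. X i \<omega> * X j \<omega>)
      = (\<Sum>i=1..n. \<Sum>j=1..n. expectation (\<lambda>\<omega>. X i \<omega> * X j \<omega>))"
    using XX by (subst Bochner_Integration.integral_sum | auto intro!: sum.cong Bochner_Integration.integrable_sum)+
  also have "\<dots> = (\<Sum>i=1..n. \<Sum>j=1..n. m\<^sup>2 + (if i = j then q - m\<^sup>2 else 0))"
    using XX by (intro sum.cong) auto
  also have "\<dots> = (real n)\<^sup>2 * m\<^sup>2 + real n * (q - m\<^sup>2)"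
    by (simp add: sum.distrib power2_eq_square algebra_simps)
  finally have ESS: "expectation (\<lambda>\<omega>. \<Sum>i=1..n. \<Sum>j=1..n. X i \<omega> * X j \<omega>) = (real n)\<^sup>2 * m\<^sup>2 + real n * (q - m\<^sup>2)" .
  have "expectation (\<lambda>\<omega>. (1 / real n * (\<Sum>i=1..n. X i \<omega>) - c)\<^sup>2)
      = expectation (\<lambda>\<omega>. 1 / (real n)\<^sup>2 * (\<Sum>i=1..n. \<Sum>j=1..n. X i \<omega> * X j \<omega>)
          - 2 * c / real n * (\<Sum>i=1..n. X i \<omega>) + c\<^sup>2)"
    by (simp add: sum_product[symmetric] power2_eq_square algebra_simps)
  also have "\<dots> = 1 / (real n)\<^sup>2 * ((real n)\<^sup>2 * m\<^sup>2 + real n * (q - m\<^sup>2)) - 2 * c / real n * (real n * m) + c\<^sup>2"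
    using S SS ESS by (simp only: Bochner_Integration.integral_add Bochner_Integration.integral_diff
      integrable_mult_right integral_mult_right_zero Bochner_Integration.integrable_diff
      lebesgue_integral_const prob_space scale_one integrable_const)
  also have "\<dots> = (m - c)\<^sup>2 + (q - m\<^sup>2) / real n"
    using \<open>n \<ge> 1\<close> by (simp add: field_simps power2_eq_square)
  finally show ?thesis .
qed

lemma integrable_circ_mult_continuous:
  fixes w v :: "real \<Rightarrow> real"
  assumes w: "integrable circ w" and v: "continuous_on UNIV v"
  shows "integrable circ (\<lambda>x. w x * v x)"
proof -
  have "compact (v ` {-pi..pi})"
    using v by (intro compact_continuous_image) (auto intro: continuous_on_subset)
  then obtain B where B: "\<And>x. x \<in> {-pi..pi} \<Longrightarrow> \<bar>v x\<bar> \<le> B"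
    by (metis bounded_iff compact_imp_bounded image_eqI real_norm_def)
  show ?thesis
  proof (rule Bochner_Integration.integrable_bound)
    show "integrable circ (\<lambda>x. w x * B)" using w by simp
    show "(\<lambda>x. w x * v x) \<in> borel_measurable circ"
      using w borel_measurable_continuous_onI[OF v] by auto
    show "AE x in circ. norm (w x * v x) \<le> norm (w x * B)"
      using B by (intro AE_I2) (force simp: abs_mult intro!: mult_left_mono)
  qed
qed

lemma times_differentiable_mono: "times_differentiable k g \<Longrightarrow> j \<le> k \<Longrightarrow> times_differentiable j g"
  by (auto simp: times_differentiable_def)

text \<open>Derivatives move one at a time from the kernel to \<open>f\<close>; generalising over
  \<open>l\<close>, the number already on \<open>f\<close>, makes the induction work. The chain-rule
  sign from \<open>\<theta> - \<phi>\<close> cancels the sign of integration by parts.\<close>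

lemma kernel_deriv_convolution:
  assumes kernel: "circular_kernel_family K" and u: "u \<in> {0..<1}"
    and diff: "times_differentiable r (K u)"
    and sq: "circular_square_integrable ((deriv ^^ r) (K u))"
    and f: "times_differentiable s f" and per: "\<And>x. f (x + 2 * pi) = f x"
  shows "i \<le> r \<Longrightarrow> l + i < s \<Longrightarrow>
    integral\<^sup>L circ (\<lambda>\<phi>. (deriv ^^ i) (K u) (\<theta> - \<phi>) * (deriv ^^ l) f \<phi>)
    = integral\<^sup>L circ (\<lambda>\<phi>. K u (\<theta> - \<phi>) * (deriv ^^ (l + i)) f \<phi>)"
proof (induction i arbitrary: l)
  case (Suc i)
  note perK = periodic_deriv_funpow[of "K u" "2 * pi", OF kernel_periodic[OF kernel u]]
  note perf = periodic_deriv_funpow[of f "2 * pi", OF per]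
  have int: "integrable circ (\<lambda>\<phi>. (deriv ^^ j) (K u) (\<theta> - \<phi>) * (deriv ^^ l') f \<phi>)"
    if "j \<le> r" "l' < s" for j l'
  proof (rule integrable_circ_mult_continuous)
    show "integrable circ (\<lambda>\<phi>. (deriv ^^ j) (K u) (\<theta> - \<phi>))"
      using kernel_deriv_integrable[OF kernel u diff sq that(1)] perK that
      by (subst integrable_circ_reflect_shift)
         (auto intro!: borel_measurable_deriv_funpow times_differentiable_mono[OF diff] kernel_measurable[OF kernel u])
    show "continuous_on UNIV ((deriv ^^ l') f)"
      by (rule times_differentiable_continuous[OF f that(2)])
  qed
  have "integral\<^sup>L circ (\<lambda>\<phi>. (- (deriv ^^ Suc i) (K u) (\<theta> - \<phi>)) * (deriv ^^ l) f \<phi>)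
      = - integral\<^sup>L circ (\<lambda>\<phi>. (deriv ^^ i) (K u) (\<theta> - \<phi>) * (deriv ^^ Suc l) f \<phi>)"
  proof (rule integral_circ_by_parts)
    show "((\<lambda>\<phi>. (deriv ^^ i) (K u) (\<theta> - \<phi>)) has_real_derivative - (deriv ^^ Suc i) (K u) (\<theta> - x)) (at x)" for x
      using DERIV_chain2[where f = "(deriv ^^ i) (K u)" and g = "\<lambda>\<phi>. \<theta> - \<phi>" and x = x and s = UNIV and Db = "-1",
          OF times_differentiable_DERIV[OF diff, of i]] Suc.prems
        DERIV_diff[OF DERIV_const DERIV_ident, of \<theta> x UNIV]
      by simp
    show "((deriv ^^ l) f has_real_derivative (deriv ^^ Suc l) f x) (at x)" for x
      using times_differentiable_DERIV[OF f] Suc.prems by simp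
    show "integrable circ (\<lambda>x. - (deriv ^^ Suc i) (K u) (\<theta> - x) * (deriv ^^ l) f x)"
      using int[of "Suc i" l] Suc.prems by simp
    show "integrable circ (\<lambda>x. (deriv ^^ i) (K u) (\<theta> - x) * (deriv ^^ Suc l) f x)"
      using int[of i "Suc l"] Suc.prems by simp
    show "(deriv ^^ i) (K u) (\<theta> - pi) * (deriv ^^ l) f pi
        = (deriv ^^ i) (K u) (\<theta> - - pi) * (deriv ^^ l) f (- pi)"
      using perK[of i "\<theta> - pi"] perf[of l "- pi"] by (simp add: add.commute)
  qed
  then show ?case using Suc.IH[of "Suc l"] Suc.prems by simp
qed simp

text \<open>The bias-variance decomposition is applied at each \<open>\<theta>\<close>, with
  \<open>q \<theta>\<close> the second moment of one summand. By translation invariance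
  \<open>q\<close> integrates to the square integral of \<open>F\<close> times the mass 1 of
  \<open>f\<close>.\<close>

lemma MISE_eq:
  fixes M :: "'w measure" and \<Theta> :: "nat \<Rightarrow> 'w \<Rightarrow> real" and f :: "real \<Rightarrow> real"
  assumes prob: "prob_space M"
    and indep: "prob_space.indep_vars M (\<lambda>_. borel) \<Theta> {1..}"
    and f_density: "circular_density f"
    and distr: "\<And>i. i \<ge> 1 \<Longrightarrow>
      distributed M lborel (\<Theta> i) (\<lambda>\<theta>. ennreal (indicator {-pi..<pi} \<theta> * f \<theta>))"
    and kernel: "circular_kernel_family K" and u: "u \<in> {0..<1}"
    and f: "times_differentiable s f" and "r < s"
    and diff: "times_differentiable r (K u)"
    and sq: "circular_square_integrable ((deriv ^^ r) (K u))"
    and "n \<ge> 1"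
  defines "m \<equiv> \<lambda>\<theta>. integral\<^sup>L circ (\<lambda>t. K u t * (deriv ^^ r) f (\<theta> - t))"
  assumes bias_sq: "integrable circ (\<lambda>\<theta>. (m \<theta> - (deriv ^^ r) f \<theta>)\<^sup>2)"
    and m_sq: "integrable circ (\<lambda>\<theta>. (m \<theta>)\<^sup>2)"
  shows "MISE M f K r \<Theta> n u = integral\<^sup>L circ (\<lambda>\<theta>. (m \<theta> - (deriv ^^ r) f \<theta>)\<^sup>2)
    + (R_K K r u - integral\<^sup>L circ (\<lambda>\<theta>. (m \<theta>)\<^sup>2)) / real n"
proof -
  interpret prob_space M by (rule prob)
  interpret circ2: pair_sigma_finite circ circ ..
  define F where "F = (deriv ^^ r) (K u)"
  define q where "q \<theta> = integral\<^sup>L circ (\<lambda>\<phi>. f \<phi> * (F (\<theta> - \<phi>))\<^sup>2)" for \<theta>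
  have [measurable]: "F \<in> borel_measurable borel"
    unfolding F_def by (rule kernel_deriv_measurable[OF kernel u diff sq])
  have [measurable]: "f \<in> borel_measurable borel" and f0: "\<And>x. 0 \<le> f x"
    and perf: "\<And>x. f (x + 2 * pi) = f x" and f1: "integral\<^sup>L circ f = 1" "integrable circ f"
    using f_density by (auto simp: circular_density_def LINT_circ set_integrable_circ periodic_fun_simple_def)
  have perF: "F (x + 2 * pi) = F x" for x
    unfolding F_def by (rule periodic_deriv_funpow) (rule kernel_periodic[OF kernel u])
  have contf: "continuous_on UNIV f"
    using times_differentiable_continuous[OF f, of 0] \<open>r < s\<close> by simp
  have F1: "integrable circ F" and F2: "integrable circ (\<lambda>x. (F x)\<^sup>2)"
    unfolding F_def using kernel_deriv_integrable[OF kernel u diff sq order_refl]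
      kernel_deriv_square_integrable[OF kernel u diff sq] by auto
  have "integrable circ (\<lambda>\<phi>. F (\<theta> - \<phi>))" "integrable circ (\<lambda>\<phi>. (F (\<theta> - \<phi>))\<^sup>2)" for \<theta>
    using F1 F2 by (subst integrable_circ_reflect_shift[of F] integrable_circ_reflect_shift[of "\<lambda>x. (F x)\<^sup>2"];
      simp add: perF)+
  then have fF1: "integrable circ (\<lambda>\<phi>. f \<phi> * F (\<theta> - \<phi>))"
    and fF2: "integrable circ (\<lambda>\<phi>. f \<phi> * (F (\<theta> - \<phi>))\<^sup>2)" for \<theta>
    using integrable_circ_mult_continuous[OF _ contf] by (simp_all add: mult.commute[of "f _"])
  \<comment> \<open>The mean of one summand appears as \<open>F\<close> against \<open>f\<close>.
    Moving the derivatives to \<open>f\<close> and substituting \<open>\<theta> - \<phi>\<close>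
    gives the form used in the bias estimates.\<close>
  have m_eq: "integral\<^sup>L circ (\<lambda>\<phi>. f \<phi> * F (\<theta> - \<phi>)) = m \<theta>" for \<theta>
  proof -
    have "integral\<^sup>L circ (\<lambda>\<phi>. f \<phi> * F (\<theta> - \<phi>)) = integral\<^sup>L circ (\<lambda>\<phi>. K u (\<theta> - \<phi>) * (deriv ^^ r) f \<phi>)"
      using kernel_deriv_convolution[OF kernel u diff sq f perf order_refl, of 0 \<theta>] \<open>r < s\<close>
      by (simp add: F_def mult.commute)
    also have "\<dots> = m \<theta>"
    proof -
      define w where "w t = K u t * (deriv ^^ r) f (\<theta> - t)" for t
      have per_w: "w (t + 2 * pi) = w t" for t
        using periodic_deriv_funpow[of f "2 * pi" r "\<theta> - (t + 2 * pi)", OF perf]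
        by (simp add: w_def kernel_periodic[OF kernel u])
      have [measurable]: "K u \<in> borel_measurable borel" "(deriv ^^ r) f \<in> borel_measurable borel"
        using kernel_measurable[OF kernel u] \<open>r < s\<close>
        by (auto intro!: borel_measurable_deriv_funpow times_differentiable_mono[OF f])
      have "integral\<^sup>L circ (\<lambda>\<phi>. w (\<theta> - \<phi>)) = integral\<^sup>L circ w"
        unfolding w_def by (rule integral_circ_reflect_shift) (use per_w in \<open>auto simp: w_def\<close>)
      then show ?thesis by (simp add: w_def[abs_def] m_def)
    qed
    finally show ?thesis .
  qed
  have law: "integrable M (\<lambda>\<omega>. G (\<Theta> i \<omega>)) \<longleftrightarrow> integrable circ (\<lambda>\<phi>. f \<phi> * G \<phi>)"
      "expectation (\<lambda>\<omega>. G (\<Theta> i \<omega>)) = integral\<^sup>L circ (\<lambda>\<phi>. f \<phi> * G \<phi>)"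
    if "i \<ge> 1" and [measurable]: "G \<in> borel_measurable borel" for i and G :: "real \<Rightarrow> real"
    using distributed_integrable[OF distr[OF that(1)], of G] distributed_integral[OF distr[OF that(1)], of G] f0
    by (simp_all add: LINT_circ[symmetric] set_integrable_circ[symmetric] set_integrable_def
        set_lebesgue_integral_def mult.assoc)
  have mse: "expectation (\<lambda>\<omega>. (kernel_deriv_estimator K r \<Theta> n u \<omega> \<theta> - c)\<^sup>2)
      = (m \<theta> - c)\<^sup>2 + (q \<theta> - (m \<theta>)\<^sup>2) / real n" for \<theta> c
    unfolding kernel_deriv_estimator_def F_def[symmetric]
  proof (rule mse_sample_mean[OF \<open>n \<ge> 1\<close>])
    have "indep_vars (\<lambda>_. borel) \<Theta> {1..n}" by (rule indep_vars_subset[OF indep]) auto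
    then show "indep_vars (\<lambda>_. borel) (\<lambda>i \<omega>. F (\<theta> - \<Theta> i \<omega>)) {1..n}"
      by (rule indep_vars_compose2) measurable
    fix i assume "i \<in> {1..n}"
    then have i: "1 \<le> i" by simp
    show "integrable M (\<lambda>\<omega>. F (\<theta> - \<Theta> i \<omega>))" "integrable M (\<lambda>\<omega>. (F (\<theta> - \<Theta> i \<omega>))\<^sup>2)"
      "expectation (\<lambda>\<omega>. F (\<theta> - \<Theta> i \<omega>)) = m \<theta>" "expectation (\<lambda>\<omega>. (F (\<theta> - \<Theta> i \<omega>))\<^sup>2) = q \<theta>"
      using law[OF i, of "\<lambda>\<phi>. F (\<theta> - \<phi>)"] law[OF i, of "\<lambda>\<phi>. (F (\<theta> - \<phi>))\<^sup>2"] fF1 fF2 m_eq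
      by (simp_all add: q_def)
  qed
  have id: "(\<lambda>t. t) \<in> measurable circ borel" by (rule measurable_circ) simp
  have [measurable]: "fst \<in> measurable (circ \<Otimes>\<^sub>M circ) borel" "snd \<in> measurable (circ \<Otimes>\<^sub>M circ) borel"
    by (rule measurable_compose[OF measurable_fst id] measurable_compose[OF measurable_snd id])+
  have prod_meas: "(\<lambda>(\<theta>, \<phi>). f \<phi> * (F (\<theta> - \<phi>))\<^sup>2) \<in> borel_measurable (circ \<Otimes>\<^sub>M circ)"
    unfolding case_prod_beta by measurable
  have q_meas: "q \<in> borel_measurable circ"
    unfolding q_def by (rule circ.borel_measurable_lebesgue_integral) (rule prod_meas)
  have q0: "0 \<le> q \<theta>" for \<theta> unfolding q_def using f0 by simp
  \<comment> \<open>Nonnegative integrals come first: the finite value found here is what proves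
    \<open>q\<close> integrable.\<close>
  have "(\<integral>\<^sup>+\<theta>. ennreal (q \<theta>) \<partial>circ) = (\<integral>\<^sup>+\<theta>. \<integral>\<^sup>+\<phi>. ennreal (f \<phi> * (F (\<theta> - \<phi>))\<^sup>2) \<partial>circ \<partial>circ)"
    unfolding q_def using f0 fF2 by (intro nn_integral_cong nn_integral_eq_integral[symmetric]) auto
  also have "\<dots> = (\<integral>\<^sup>+\<phi>. \<integral>\<^sup>+\<theta>. ennreal (f \<phi> * (F (\<theta> - \<phi>))\<^sup>2) \<partial>circ \<partial>circ)"
    using prod_meas by (intro circ2.Fubini'[symmetric]) (auto simp: case_prod_beta)
  also have "\<dots> = (\<integral>\<^sup>+\<phi>. ennreal (f \<phi>) * ennreal (integral\<^sup>L circ (\<lambda>x. (F x)\<^sup>2)) \<partial>circ)"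
  proof (rule nn_integral_cong)
    fix \<phi>
    have "(\<integral>\<^sup>+\<theta>. ennreal (f \<phi> * (F (\<theta> - \<phi>))\<^sup>2) \<partial>circ)
        = ennreal (f \<phi>) * (\<integral>\<^sup>+\<theta>. ennreal ((F (\<theta> + - \<phi>))\<^sup>2) \<partial>circ)"
      using f0 by (subst nn_integral_cmult[symmetric]) (auto simp: ennreal_mult)
    also have "(\<integral>\<^sup>+\<theta>. ennreal ((F (\<theta> + - \<phi>))\<^sup>2) \<partial>circ) = (\<integral>\<^sup>+\<theta>. ennreal ((F \<theta>)\<^sup>2) \<partial>circ)"
      by (rule nn_integral_circ_shift[of "\<lambda>x. ennreal ((F x)\<^sup>2)"]) (auto simp: perF)
    also have "\<dots> = ennreal (integral\<^sup>L circ (\<lambda>x. (F x)\<^sup>2))"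
      by (rule nn_integral_eq_integral[OF F2]) auto
    finally show "(\<integral>\<^sup>+\<theta>. ennreal (f \<phi> * (F (\<theta> - \<phi>))\<^sup>2) \<partial>circ)
        = ennreal (f \<phi>) * ennreal (integral\<^sup>L circ (\<lambda>x. (F x)\<^sup>2))" .
  qed
  also have "\<dots> = (\<integral>\<^sup>+\<phi>. ennreal (f \<phi>) \<partial>circ) * ennreal (integral\<^sup>L circ (\<lambda>x. (F x)\<^sup>2))"
    by (rule nn_integral_multc) measurable
  also have "(\<integral>\<^sup>+\<phi>. ennreal (f \<phi>) \<partial>circ) = 1"
    using nn_integral_eq_integral[OF f1(2)] f0 f1(1) by simp
  also have "integral\<^sup>L circ (\<lambda>x. (F x)\<^sup>2) = R_K K r u"
    unfolding F_def by (rule R_K_eq[OF kernel u diff sq, symmetric])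
  finally have nn_q: "(\<integral>\<^sup>+\<theta>. ennreal (q \<theta>) \<partial>circ) = ennreal (R_K K r u)" by simp
  have "0 \<le> R_K K r u" unfolding R_K_eq[OF kernel u diff sq] by simp
  with nn_q q0 q_meas have iq: "integrable circ q" "integral\<^sup>L circ q = R_K K r u"
    using nn_integral_eq_integrable[of q circ "R_K K r u"] by auto
  have "MISE M f K r \<Theta> n u = integral\<^sup>L circ (\<lambda>\<theta>. (m \<theta> - (deriv ^^ r) f \<theta>)\<^sup>2 + (q \<theta> - (m \<theta>)\<^sup>2) / real n)"
    unfolding MISE_def LINT_circ mse ..
  also have "\<dots> = integral\<^sup>L circ (\<lambda>\<theta>. (m \<theta> - (deriv ^^ r) f \<theta>)\<^sup>2)
    + (R_K K r u - integral\<^sup>L circ (\<lambda>\<theta>. (m \<theta>)\<^sup>2)) / real n"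
    using bias_sq m_sq iq by simp
  finally show ?thesis .
qed

section \<open>Rates and leading terms of the mean integrated squared error\<close>

theorem theorem1:
  fixes r :: nat
    and M :: "'w measure"
    and \<Theta> :: "nat \<Rightarrow> 'w \<Rightarrow> real"
    and f :: "real \<Rightarrow> real"
    and K :: "real \<Rightarrow> real \<Rightarrow> real"
    and \<nu> :: "nat \<Rightarrow> real"
  assumes prob: "prob_space M"
    and indep: "prob_space.indep_vars M (\<lambda>_. borel) \<Theta> {1..}"
    and f_density: "circular_density f"
    and distr: "\<And>i. i \<ge> 1 \<Longrightarrow>
      distributed M lborel (\<Theta> i) (\<lambda>\<theta>. ennreal (indicator {-pi..<pi} \<theta> * f \<theta>))"
    and kernel: "circular_kernel_family K"
    and nu: "\<And>n. \<nu> n \<in> {0..<1}"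
    and A1: "times_differentiable (r + 2) f"
      "continuous_on UNIV ((deriv ^^ (r + 2)) f)"
      "circular_square_integrable ((deriv ^^ (r + 2)) f)"
    and A2: "\<And>u. u \<in> {0..<1} \<Longrightarrow> bounded (range (K u))"
      "\<And>u. u \<in> {0..<1} \<Longrightarrow> times_differentiable r (K u)"
      "\<And>u. u \<in> {0..<1} \<Longrightarrow> circular_square_integrable ((deriv ^^ r) (K u))"
    and A3: "(\<lambda>n. h_K K (\<nu> n)) \<longlonglongrightarrow> 0"
      "filterlim (\<lambda>n. R_K K r (\<nu> n)) at_top sequentially"
      "(\<lambda>n. R_K K r (\<nu> n) / real n) \<longlonglongrightarrow> 0"
  shows
    "(\<exists>a b. a \<in> O(\<lambda>n. (h_K K (\<nu> n))\<^sup>2) \<and> b \<in> O(\<lambda>n. R_K K r (\<nu> n) / real n) \<and>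
            (\<forall>n. MISE M f K r \<Theta> n (\<nu> n) = a n + b n)) \<and>
     ((\<lambda>n. LINT \<theta>:{-pi..<pi}|lborel. \<theta> ^ 4 * K (\<nu> n) \<theta>) \<in> o(\<lambda>n. h_K K (\<nu> n)) \<longrightarrow>
      (\<lambda>n. LINT \<theta>:{-pi..<pi}|lborel. \<theta>\<^sup>2 * ((deriv ^^ r) (K (\<nu> n)) \<theta>)\<^sup>2)
        \<in> o(\<lambda>n. R_K K r (\<nu> n)) \<longrightarrow>
      (\<lambda>n. MISE M f K r \<Theta> n (\<nu> n) -
           (1 / 4 * (h_K K (\<nu> n))\<^sup>2 * (LINT \<theta>:{-pi..<pi}|lborel. ((deriv ^^ (r + 2)) f \<theta>)\<^sup>2) +
            1 / real n * R_K K r (\<nu> n)))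
        \<in> o(\<lambda>n. (h_K K (\<nu> n))\<^sup>2 + R_K K r (\<nu> n) / real n))"
proof -
  let ?R = "\<lambda>n. R_K K r (\<nu> n)" and ?h = "\<lambda>n. h_K K (\<nu> n)"
  let ?g = "(deriv ^^ r) f" and ?g2 = "(deriv ^^ (r + 2)) f"
  define m where "m n \<theta> = integral\<^sup>L circ (\<lambda>t. K (\<nu> n) t * ?g (\<theta> - t))" for n \<theta>
  define b where "b n = integral\<^sup>L circ (\<lambda>\<theta>. (m n \<theta> - ?g \<theta>)\<^sup>2)" for n
  define V where "V n = integral\<^sup>L circ (\<lambda>\<theta>. (m n \<theta>)\<^sup>2)" for n
  define J where "J = integral\<^sup>L circ (\<lambda>\<theta>. (?g2 \<theta>)\<^sup>2)"

  have perf: "f (x + 2 * pi) = f x" for x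
    using f_density by (simp add: circular_density_def periodic_fun_simple_def)
  have per: "(deriv ^^ j) f (x + 2 * pi) = (deriv ^^ j) f x" for j x
    by (rule periodic_deriv_funpow) (rule perf)
  have g1: "(?g has_real_derivative (deriv ^^ Suc r) f x) (at x)"
    and g2: "((deriv ^^ Suc r) f has_real_derivative ?g2 x) (at x)" for x
    using times_differentiable_DERIV[OF A1(1), of r x] times_differentiable_DERIV[OF A1(1), of "Suc r" x]
    by simp_all
  have cont_g: "continuous_on UNIV ?g"
    using times_differentiable_continuous[OF A1(1), of r] by simp
  obtain G where G: "\<And>x. \<bar>?g x\<bar> \<le> G"
    using periodic_continuous_bounded[OF cont_g per] by blast
  obtain B0 where B0: "\<And>x. \<bar>?g2 x\<bar> \<le> B0"
    using periodic_continuous_bounded[OF A1(2) per] by blast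
  \<comment> \<open>Enlarging \<open>B0\<close> by 1 makes the bound strictly positive, since
    \<open>e\<close> and \<open>\<eta>\<close> below divide by it.\<close>
  define B where "B = B0 + 1"
  have B: "\<bar>?g2 x\<bar> \<le> B" for x using B0[of x] by (simp add: B_def)
  have Bpos: "B > 0" using B0[of 0] by (simp add: B_def)

  note k = continuous_kernel[OF kernel nu] kernel_nonneg[OF kernel nu] kernel_even[OF kernel nu]
    integral_kernel[OF kernel nu]
  note h = h_K_eq[OF kernel nu]
  note bias = k h g1 g2 B
  have h0: "0 \<le> ?h n" for n by (rule second_moment_nonneg[OF bias])
  have R: "?R n = integral\<^sup>L circ (\<lambda>x. ((deriv ^^ r) (K (\<nu> n)) x)\<^sup>2)" for n
    by (rule R_K_eq[OF kernel nu A2(2)[OF nu] A2(3)[OF nu]])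
  have R0: "0 \<le> ?R n" for n unfolding R by simp
  have b_int: "integrable circ (\<lambda>\<theta>. (m n \<theta> - ?g \<theta>)\<^sup>2)" for n
    unfolding m_def by (rule integrable_bias_square[OF bias])
  have b_le: "b n \<le> 2 * pi * (?h n * B / 2)\<^sup>2" for n
    unfolding b_def m_def by (rule integral_bias_square_le[OF bias])
  have b0: "0 \<le> b n" for n unfolding b_def by simp
  have m_bd: "(m n \<theta>)\<^sup>2 \<le> G\<^sup>2" for n \<theta>
  proof -
    have "\<bar>m n \<theta>\<bar> \<le> integral\<^sup>L circ (\<lambda>t. norm (K (\<nu> n) t * ?g (\<theta> - t)))"
      unfolding m_def using Bochner_Integration.integral_norm_bound[of circ "\<lambda>t. K (\<nu> n) t * ?g (\<theta> - t)"] by simp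
    also have "\<dots> \<le> integral\<^sup>L circ (\<lambda>t. K (\<nu> n) t * G)"
    proof (rule integral_mono)
      have "continuous_on UNIV (\<lambda>t. ?g (\<theta> - t))"
        by (rule continuous_on_compose2[OF cont_g]) (auto intro!: continuous_intros)
      then show "integrable circ (\<lambda>t. norm (K (\<nu> n) t * ?g (\<theta> - t)))" "integrable circ (\<lambda>t. K (\<nu> n) t * G)"
        by (intro integrable_circ_continuous continuous_on_norm continuous_on_mult k(1) continuous_on_const; assumption)+
      show "norm (K (\<nu> n) t * ?g (\<theta> - t)) \<le> K (\<nu> n) t * G" for t
        using k(2)[of n t] G[of "\<theta> - t"] by (simp add: abs_mult mult_left_mono)
    qed
    also have "\<dots> = G" using k(4)[of n] by simp
    finally show ?thesis using power_mono[of "\<bar>m n \<theta>\<bar>" G 2] by simp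
  qed
  have m_meas: "m n \<in> borel_measurable borel" for n
    unfolding m_def
    by (intro convolution_measurable borel_measurable_continuous_onI k(1) cont_g)
  have V_int: "integrable circ (\<lambda>\<theta>. (m n \<theta>)\<^sup>2)" for n
    using m_bd m_meas by (intro integrable_circ_bounded[where B = "G\<^sup>2"]) auto
  have V0: "0 \<le> V n" for n unfolding V_def by simp
  have V_le: "V n \<le> 2 * pi * G\<^sup>2" for n
  proof -
    have "V n \<le> integral\<^sup>L circ (\<lambda>\<theta>. G\<^sup>2)"
      unfolding V_def by (intro integral_mono V_int m_bd) simp
    then show ?thesis by (simp only: integral_circ_const)
  qed
  have MISE: "MISE M f K r \<Theta> n (\<nu> n) = b n + (?R n - V n) / real n" if "n \<ge> 1" for n
    unfolding b_def V_def m_def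
    by (rule MISE_eq[OF prob indep f_density distr kernel nu A1(1) _ A2(2)[OF nu] A2(3)[OF nu] that])
       (use b_int V_int in \<open>simp_all add: m_def\<close>)
  have R_large: "eventually (\<lambda>n. C \<le> ?R n) sequentially" for C
    using A3(2) by (simp add: filterlim_at_top)

  have "\<exists>a c. a \<in> O(\<lambda>n. (?h n)\<^sup>2) \<and> c \<in> O(\<lambda>n. ?R n / real n) \<and>
            (\<forall>n. MISE M f K r \<Theta> n (\<nu> n) = a n + c n)"
  proof (intro exI conjI allI)
    \<comment> \<open>The exact identity holds for \<open>n \<ge> 1\<close>. At \<open>n = 0\<close>
      the first term absorbs the whole MISE, and \<open>?c 0\<close> is 0 because division by zero
      gives 0.\<close>
    let ?a = "\<lambda>n. if n = 0 then MISE M f K r \<Theta> 0 (\<nu> 0) else b n"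
    let ?c = "\<lambda>n. (?R n - V n) / real n"
    have "norm (b n) \<le> 2 * pi * (B / 2)\<^sup>2 * norm ((?h n)\<^sup>2)" for n
      using b_le[of n] b0[of n] by (simp add: power_mult_distrib power_divide field_simps)
    then show "?a \<in> O(\<lambda>n. (?h n)\<^sup>2)"
      by (intro bigoI[where c = "2 * pi * (B / 2)\<^sup>2"] eventually_mono[OF eventually_gt_at_top[of 0]]) simp
    show "?c \<in> O(\<lambda>n. ?R n / real n)"
    proof (rule bigoI)
      \<comment> \<open>Once \<open>R_K\<close> exceeds \<open>2 * pi * G^2\<close>,
        \<open>V n\<close> lies between 0 and \<open>R_K\<close>, so the constant 1 works.\<close>
      show "eventually (\<lambda>n. norm (?c n) \<le> 1 * norm (?R n / real n)) sequentially"
        using R_large[of "2 * pi * G\<^sup>2"]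
      proof eventually_elim
        case (elim n)
        then have "\<bar>?R n - V n\<bar> \<le> ?R n" using V0[of n] V_le[of n] by linarith
        then show ?case using R0[of n] by (simp add: divide_right_mono)
      qed
    qed
    show "MISE M f K r \<Theta> n (\<nu> n) = ?a n + ?c n" for n
      using MISE[of n] by (cases "n = 0") auto
  qed
  moreover have "(\<lambda>n. MISE M f K r \<Theta> n (\<nu> n) - (1 / 4 * (?h n)\<^sup>2 * J + 1 / real n * ?R n))
        \<in> o(\<lambda>n. (?h n)\<^sup>2 + ?R n / real n)"
    if E1: "(\<lambda>n. integral\<^sup>L circ (\<lambda>\<theta>. \<theta> ^ 4 * K (\<nu> n) \<theta>)) \<in> o(\<lambda>n. ?h n)"
  proof (rule landau_o.smallI)
    fix \<epsilon> :: real assume \<epsilon>: "\<epsilon> > 0"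
    \<comment> \<open>Chosen so that the near part of the bias error,
      \<open>2 * pi * (h * e / 2) * (h * B)\<close>, is exactly half of
      \<open>\<epsilon> * h^2\<close>.\<close>
    define e where "e = \<epsilon> / (2 * pi * B)"
    have "e > 0" using \<epsilon> Bpos by (simp add: e_def)
    then obtain d where d: "d > 0" "\<And>x y. \<bar>y - x\<bar> < d \<Longrightarrow> \<bar>?g2 y - ?g2 x\<bar> \<le> e"
      using periodic_uniformly_continuous[OF A1(2) per] by metis
    \<comment> \<open>Chosen so that the fourth-moment part,
      \<open>2 * pi * \<eta> * h * (B / d^2) * (h * B)\<close>, is the other half.\<close>
    define \<eta> where "\<eta> = \<epsilon> * d\<^sup>2 / (4 * pi * B\<^sup>2)"
    have "\<eta> > 0" using \<epsilon> Bpos d by (simp add: \<eta>_def)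
    with E1 have "eventually (\<lambda>n. norm (integral\<^sup>L circ (\<lambda>\<theta>. \<theta> ^ 4 * K (\<nu> n) \<theta>)) \<le> \<eta> * norm (?h n)) sequentially"
      by (rule landau_o.smallD)
    then show "eventually (\<lambda>n. norm (MISE M f K r \<Theta> n (\<nu> n) - (1 / 4 * (?h n)\<^sup>2 * J + 1 / real n * ?R n))
        \<le> \<epsilon> * norm ((?h n)\<^sup>2 + ?R n / real n)) sequentially"
      using R_large[of "2 * pi * G\<^sup>2 / \<epsilon>"] eventually_ge_at_top[of 1]
    proof eventually_elim
      case (elim n)
      let ?M4 = "integral\<^sup>L circ (\<lambda>\<theta>. \<theta> ^ 4 * K (\<nu> n) \<theta>)"
      have "?M4 * (B / d\<^sup>2) \<le> \<eta> * ?h n * (B / d\<^sup>2)"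
        using elim(1) h0[of n] Bpos by (intro mult_right_mono) auto
      then have "(?h n * e / 2 + ?M4 * (B / d\<^sup>2)) * (?h n * B)
          \<le> (?h n * e / 2 + \<eta> * ?h n * (B / d\<^sup>2)) * (?h n * B)"
        using h0[of n] Bpos by (intro mult_right_mono) auto
      then have "2 * pi * ((?h n * e / 2 + ?M4 * (B / d\<^sup>2)) * (?h n * B))
          \<le> 2 * pi * ((?h n * e / 2 + \<eta> * ?h n * (B / d\<^sup>2)) * (?h n * B))"
        by (intro mult_left_mono) auto
      also have "\<dots> = \<epsilon> * (?h n)\<^sup>2"
        using Bpos d(1) by (simp add: e_def \<eta>_def field_simps power2_eq_square)
      finally have bias_err: "\<bar>b n - 1 / 4 * (?h n)\<^sup>2 * J\<bar> \<le> \<epsilon> * (?h n)\<^sup>2"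
        using integral_bias_square_expansion[OF bias d, of n] unfolding b_def m_def J_def by linarith
      \<comment> \<open>The threshold \<open>2 * pi * G^2 / \<epsilon>\<close> for
        \<open>R_K\<close> is the bound on \<open>V n\<close> divided by the tolerance.\<close>
      have "V n \<le> \<epsilon> * ?R n"
        using V_le[of n] elim(2) \<epsilon> by (simp add: field_simps)
      then have var_err: "\<bar>V n / real n\<bar> \<le> \<epsilon> * (?R n / real n)"
        using V0[of n] by (simp add: divide_right_mono)
      have "MISE M f K r \<Theta> n (\<nu> n) - (1 / 4 * (?h n)\<^sup>2 * J + 1 / real n * ?R n)
          = (b n - 1 / 4 * (?h n)\<^sup>2 * J) - V n / real n"
        using MISE[OF elim(3)] by (simp add: diff_divide_distrib)
      then have "norm (MISE M f K r \<Theta> n (\<nu> n) - (1 / 4 * (?h n)\<^sup>2 * J + 1 / real n * ?R n))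
          \<le> \<bar>b n - 1 / 4 * (?h n)\<^sup>2 * J\<bar> + \<bar>V n / real n\<bar>"
        by (simp only: real_norm_def abs_triangle_ineq4)
      also have "\<dots> \<le> \<epsilon> * ((?h n)\<^sup>2 + ?R n / real n)"
        unfolding distrib_left by (rule add_mono[OF bias_err var_err])
      finally show ?case using R0[of n] by simp
    qed
  qed
  ultimately show ?thesis
    unfolding LINT_circ J_def by blast
qed

end
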